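(* Let $C(z)=\sum_{n\ge1} n^{n-1}\frac{z^n}{n!}$ be the Cayley tree function, i.e. the power series solution of $C(z)=z\exp(C(z))$. For $n\ge 1$ let $t_n$ (resp. $r_n$, $g_n$) be the number of pairs $(D,c)$ where $D$ is a rooted labeled directed tree on the vertex set $\{1,\dots,n\}$ and $c$ is a well-coloring of $D$ (resp. a well-coloring in which the root is red, resp. green). Let $T(z)=\sum_n t_n z^n/n!$, $T_r(z)=\sum_n r_n z^n/n!$, $T_g(z)=\sum_n g_n z^n/n!$. Then $$T(z)=\frac{C(2z)}{2},\qquad T_r(z)=-C\!\left(-\frac{C(2z)}{2}\right),\qquad T_g(z)=\frac{C(2z)}{2}+C\!\left(-\frac{C(2z)}{2}\right).$$ Moreover, define the "unrooted" series $T^{unr.}(z)=\sum_{n\ge1}\frac{t_n}{n}\frac{z^n}{n!}$, $T_r^{unr.}(z)=\sum_{n\ge1}\frac{r_n}{n}\frac{z^n}{n!}$, $T_g^{unr.}(z)=\sum_{n\ge1}\frac{g_n}{n}\frac{z^n}{n!}$ (so that $T^{unr.}$ is the exponential generating function of unrooted well-colored labeled directed trees). Then $$T^{unr.}=T-T^2,\qquad T_g^{unr.}=T^{unr.}-T_r^{unr.},\qquad T_r^{unr.}=2+2T-2T\,T_r+T_r-\frac{2T}{T_r}+\frac{T_r^2}{2}.$$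
   Context: All digraphs are finite, without loops and without multiple arcs (two opposite arcs $(u,v)$ and $(v,u)$ may both be present). A child (out-neighbour) of a vertex $u$ is a vertex $v$ with $(u,v)$ an arc. A well-coloring of a digraph is a coloring of each vertex red or green such that every green vertex has at least one red child and no red vertex has a red child; the set of red vertices is then exactly a kernel (an independent set $K$ such that every vertex outside $K$ has an arc into $K$). A labeled directed tree on $\{1,\dots,n\}$ is a digraph whose underlying undirected graph is a tree (each edge oriented in one of the two directions); rooted means one vertex is distinguished as the root. Exponential generating functions use $z$ to mark vertices. *)

theory Defs
  imports
    "HOL-Library.FuncSet"
    "HOL-Computational_Algebra.Formal_Power_Series"
    "Graph_Theory.Digraph_Component"
begin

text \<open>
  The constants \<open>forest\<close> and \<open>tree\<close> of Graph_Theory only exclude directed cycles (so a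
  transitively oriented triangle is a \<open>tree\<close> there).  Here the underlying undirected graph has to
  be a tree.  It is represented by the symmetric closure of the digraph, in which every edge
  traversed back and forth is a closed walk of length 2 that counts as a \<open>cycle\<close>; cycles of the
  undirected graph are those of length at least 3.  Antisymmetry says that each edge is oriented in
  only one of its two directions.
\<close>

definition directed_tree :: "'a pair_pre_digraph \<Rightarrow> bool" where
  "directed_tree D \<longleftrightarrow>
     pair_digraph D \<and> antisym (parcs D) \<and>
     Digraph_Component.connected (with_proj D) \<and>
     \<not> (\<exists>p. pre_digraph.cycle (with_proj (mk_symmetric (with_proj D))) p \<and> 3 \<le> length p)"

definition labeled_directed_tree :: "nat \<Rightarrow> nat pair_pre_digraph \<Rightarrow> bool" where
  "labeled_directed_tree n D \<longleftrightarrow> pverts D = {1..n} \<and> directed_tree D"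

datatype color = Red | Green

text \<open>Colorings are extensional functions, so that they can be counted.\<close>

definition well_coloring :: "'a pair_pre_digraph \<Rightarrow> ('a \<Rightarrow> color) \<Rightarrow> bool" where
  "well_coloring D c \<longleftrightarrow>
     c \<in> extensional (pverts D) \<and>
     (\<forall>u\<in>pverts D. c u = Green \<longrightarrow> (\<exists>v. (u, v) \<in> parcs D \<and> c v = Red)) \<and>
     (\<forall>u\<in>pverts D. c u = Red \<longrightarrow> \<not> (\<exists>v. (u, v) \<in> parcs D \<and> c v = Red))"

definition rooted_well_colored :: "nat \<Rightarrow> ((nat pair_pre_digraph \<times> nat) \<times> (nat \<Rightarrow> color)) set" where
  "rooted_well_colored n =
     {((D, v), c). labeled_directed_tree n D \<and> v \<in> pverts D \<and> well_coloring D c}"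

definition num_t :: "nat \<Rightarrow> nat" where
  "num_t n = card (rooted_well_colored n)"

definition num_r :: "nat \<Rightarrow> nat" where
  "num_r n = card {((D, v), c) \<in> rooted_well_colored n. c v = Red}"

definition num_g :: "nat \<Rightarrow> nat" where
  "num_g n = card {((D, v), c) \<in> rooted_well_colored n. c v = Green}"

definition num_unrooted :: "nat \<Rightarrow> nat" where
  "num_unrooted n = card {(D, c). labeled_directed_tree n D \<and> well_coloring D c}"

text \<open>Exponential generating functions; all sums start at index 1.\<close>

definition egf :: "(nat \<Rightarrow> rat) \<Rightarrow> rat fps" where
  "egf a = Abs_fps (\<lambda>n. if n = 0 then 0 else a n / fact n)"

definition cayley :: "rat fps" where
  "cayley = egf (\<lambda>n. of_nat n ^ (n - 1))"

definition T :: "rat fps" where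
  "T = egf (\<lambda>n. of_nat (num_t n))"

definition T_r :: "rat fps" where
  "T_r = egf (\<lambda>n. of_nat (num_r n))"

definition T_g :: "rat fps" where
  "T_g = egf (\<lambda>n. of_nat (num_g n))"

definition T_unr :: "rat fps" where
  "T_unr = egf (\<lambda>n. of_nat (num_t n) / of_nat n)"

definition T_r_unr :: "rat fps" where
  "T_r_unr = egf (\<lambda>n. of_nat (num_r n) / of_nat n)"

definition T_g_unr :: "rat fps" where
  "T_g_unr = egf (\<lambda>n. of_nat (num_g n) / of_nat n)"

end

theory Submission
  imports Defs
begin

text \<open>
  Call a vertex satisfied if it obeys the coloring rule.  Consider rooted trees in which every vertex
  except possibly the root is satisfied, and let \<open>R\<close>, \<open>A\<close>, \<open>N\<close> be the series of those with a satisfied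
  red root, with a green root, and with a green root without red child; the green satisfied roots
  have series \<open>G = A - N\<close>.  Detaching the branches at the root gives \<open>A = X exp (2 (R + G))\<close>,
  \<open>R = X exp (G + A)\<close> and \<open>N = X exp (G + (R + G))\<close>, where the two summands correspond to the two
  orientations of the arc to a branch.  Solving yields \<open>A = T\<close> and \<open>N = R\<close>, hence \<open>T = X exp (2 T)\<close>
  and \<open>R = X exp (2 T - R)\<close>.

  The exponentials are avoided on the combinatorial side: an equation \<open>F = X exp H\<close> is equivalent to
  \<open>X F' = F + F \<cdot> X H'\<close>, and this says that marking a vertex other than the root amounts to cutting off
  the single branch that contains it.  As the resulting recurrence refers only to smaller vertex sets,
  it also shows that the counts depend only on the number of vertices.
\<close>

unbundle fps_syntax

section \<open>The Cayley tree function\<close>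

text \<open>As \<open>b\<close> has constant term 0, \<open>b ^ i\<close> contributes nothing below
  index \<open>i\<close>, so the coefficients of \<open>a oo b\<close> up to \<open>n\<close> can
  all be summed to the common bound \<open>n\<close>.\<close>

lemma fps_compose_mult_nth:
  fixes a b c :: "'a::comm_ring_1 fps"
  assumes "b $ 0 = 0"
  shows "((a oo b) * c) $ n = (\<Sum>i\<le>n. a $ i * (b ^ i * c) $ n)"
proof -
  have *: "(a oo b) $ k = (\<Sum>i\<le>n. a $ i * (b ^ i) $ k)" if "k \<le> n" for k
    unfolding fps_compose_nth using that assms
    by (intro sum.mono_neutral_left) (auto simp: startsby_zero_power_prefix)
  have "((a oo b) * c) $ n = (\<Sum>k\<le>n. (\<Sum>i\<le>n. a $ i * (b ^ i) $ k) * c $ (n - k))"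
    unfolding fps_mult_nth atLeast0AtMost by (intro sum.cong) (auto simp: *)
  also have "\<dots> = (\<Sum>i\<le>n. \<Sum>k\<le>n. a $ i * ((b ^ i) $ k * c $ (n - k)))"
    unfolding sum_distrib_right by (subst sum.swap) (simp add: mult.assoc)
  also have "\<dots> = (\<Sum>i\<le>n. a $ i * (b ^ i * c) $ n)"
    by (simp add: fps_mult_nth sum_distrib_left atLeast0AtMost)
  finally show ?thesis .
qed

lemma fps_eq_1_if_deriv_0: "fps_deriv u = 0 \<Longrightarrow> u $ 0 = 1 \<Longrightarrow> u = 1"
  for u :: "'a::field_char_0 fps"
  by (metis fps_const_1_eq_1 fps_deriv_eq_0_iff)

text \<open>Both sides are inverse to the exponential of \<open>- (f + g)\<close>: the products
  \<open>u\<close> and \<open>v\<close> have derivative 0 and constant term 1.\<close>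

lemma fps_exp_compose_add:
  fixes f g :: "'a::field_char_0 fps"
  assumes "f $ 0 = 0" "g $ 0 = 0"
  shows "fps_exp 1 oo (f + g) = (fps_exp 1 oo f) * (fps_exp 1 oo g)"
proof -
  have d: "fps_deriv (fps_exp 1 oo h) = fps_deriv h * (fps_exp 1 oo h)" if "h $ 0 = 0" for h :: "'a fps"
    using that by (simp add: fps_compose_deriv)
  define u where "u = (fps_exp 1 oo f) * (fps_exp 1 oo g) * (fps_exp 1 oo - (f + g))"
  have "fps_deriv u = 0"
    unfolding u_def using assms by (simp add: d algebra_simps)
  hence "u = 1" by (rule fps_eq_1_if_deriv_0) (simp add: u_def)
  define v where "v = (fps_exp 1 oo (f + g)) * (fps_exp 1 oo - (f + g))"
  have "fps_deriv v = 0"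
    unfolding v_def using assms by (simp add: d algebra_simps)
  hence "v = 1" by (rule fps_eq_1_if_deriv_0) (simp add: v_def)
  have "(fps_exp 1 oo (f + g)) = (fps_exp 1 oo (f + g)) * u" using \<open>u = 1\<close> by simp
  also have "\<dots> = (fps_exp 1 oo f) * (fps_exp 1 oo g) * v" by (simp add: u_def v_def algebra_simps)
  finally show ?thesis using \<open>v = 1\<close> by simp
qed

lemma fps_exp_compose_minus:
  fixes f :: "'a::field_char_0 fps"
  assumes "f $ 0 = 0"
  shows "(fps_exp 1 oo f) * (fps_exp 1 oo - f) = 1"
  using fps_exp_compose_add[of f "- f"] assms by simp

lemma egf_nth: "egf a $ n = (if n = 0 then 0 else a n / fact n)"
  by (simp add: egf_def)

lemma egf_0 [simp]: "egf a $ 0 = 0"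
  by (simp add: egf_nth)

section \<open>The compositional inverse \<open>X exp (- X)\<close> of the Cayley function, and
  Lagrange inversion\<close>

definition tree_inverse :: "rat fps" where
  "tree_inverse = fps_X * fps_exp (- 1)"

lemma tree_inverse_power: "tree_inverse ^ k = fps_X ^ k * fps_exp (- of_nat k)"
  by (simp add: tree_inverse_def power_mult_distrib fps_exp_power_mult)

lemma fps_deriv_tree_inverse: "fps_deriv tree_inverse = (1 - fps_X) * fps_exp (- 1)"
  by (simp add: tree_inverse_def algebra_simps fps_const_neg[symmetric] del: fps_const_neg)

lemma tree_inverse_0 [simp]: "tree_inverse $ 0 = 0" and tree_inverse_1 [simp]: "tree_inverse $ Suc 0 = 1"
  by (simp_all add: tree_inverse_def)

text \<open>The Lagrange inversion argument with denominators cleared: with \<open>H = X exp (- X)\<close> and \<open>G\<close> the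
  derivative of its inverse, comparing coefficients in \<open>1 = (G \<circ> H) H'\<close> after multiplication by
  \<open>exp ((n + 1) X)\<close> leaves a single nonzero term.\<close>

lemma fps_inv_tree_inverse_nth:
  "fps_inv tree_inverse $ Suc n = of_nat (Suc n) ^ n / fact (Suc n)"
proof -
  define G where "G = fps_deriv (fps_inv tree_inverse)"
  have c1: "(G oo tree_inverse) * fps_deriv tree_inverse = 1"
    unfolding G_def by (simp add: fps_compose_deriv[symmetric] fps_inv)
  let ?e = "fps_exp (of_nat (Suc n)) :: rat fps"
  have coeff: "(tree_inverse ^ i * (fps_deriv tree_inverse * ?e)) $ n = (if i = n then 1 else 0)"
    if "i \<le> n" for i
  proof -
    define m where "m = n - i"
    have e: "fps_exp (- of_nat i) * fps_exp (- 1) * ?e = (fps_exp (of_nat m) :: rat fps)"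
      unfolding fps_exp_add_mult[symmetric] using that by (simp add: m_def of_nat_diff)
    have "tree_inverse ^ i * (fps_deriv tree_inverse * ?e) =
        fps_X ^ i * ((1 - fps_X) * (fps_exp (- of_nat i) * fps_exp (- 1) * ?e))"
      unfolding tree_inverse_power fps_deriv_tree_inverse by (simp add: mult_ac)
    also have "\<dots> = fps_X ^ i * (fps_exp (of_nat m) - fps_X * fps_exp (of_nat m))"
      unfolding e by (simp add: algebra_simps)
    also have "\<dots> $ n = (fps_exp (of_nat m) - fps_X * fps_exp (of_nat m) :: rat fps) $ m"
      using that by (simp add: fps_X_power_mult_nth m_def)
    \<comment> \<open>For \<open>m > 0\<close> the coefficients \<open>m^m / m!\<close> and
      \<open>m^(m-1) / (m-1)!\<close> coincide and cancel.\<close>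
    also have "\<dots> = (if m = 0 then 1 else 0)"
      by (cases m) (simp_all add: fact_Suc[of _, where ?'a = rat] del: of_nat_Suc fact_Suc)
    finally show ?thesis using that by (simp add: m_def)
  qed
  have "of_nat (Suc n) ^ n / fact n = ?e $ n" by simp
  also have "?e = ((G oo tree_inverse) * fps_deriv tree_inverse) * ?e" unfolding c1 by simp
  also have "\<dots> = (G oo tree_inverse) * (fps_deriv tree_inverse * ?e)" by (simp add: mult.assoc)
  also have "\<dots> $ n = (\<Sum>i\<le>n. G $ i * (if i = n then 1 else 0))"
    unfolding fps_compose_mult_nth[OF tree_inverse_0] by (rule sum.cong[OF refl]) (simp only: coeff atMost_iff)
  also have "\<dots> = of_nat (Suc n) * fps_inv tree_inverse $ Suc n"
    by (simp add: G_def mult_delta_right)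
  finally show ?thesis
    by (simp del: of_nat_Suc add: field_simps)
qed

lemma cayley_eq_fps_inv: "cayley = fps_inv tree_inverse"
proof (rule fps_ext)
  fix n show "cayley $ n = fps_inv tree_inverse $ n"
  proof (cases n)
    case 0 then show ?thesis by (simp add: cayley_def egf_def fps_inv_def)
  next
    case (Suc m) then show ?thesis
      by (simp only: fps_inv_tree_inverse_nth) (simp add: cayley_def egf_def)
  qed
qed

lemma cayley_0 [simp]: "cayley $ 0 = 0" by (simp add: cayley_def)

text \<open>The exponential of \<open>F\<close> is a unit with inverse the exponential of
  \<open>- F\<close>. Moving it to the left turns the fixed point equation into the explicit one
  \<open>tree_inverse oo F = G\<close>.\<close>

lemma tree_functional_equation_iff:
  fixes F G :: "rat fps"
  assumes "F $ 0 = 0"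
  shows "F = G * (fps_exp 1 oo F) \<longleftrightarrow> F * (fps_exp 1 oo - F) = G"
proof -
  define E E' where "E = fps_exp 1 oo F" and "E' = fps_exp 1 oo - F"
  have 1: "E * E' = 1" unfolding E_def E'_def by (rule fps_exp_compose_minus) fact
  show ?thesis unfolding E_def[symmetric] E'_def[symmetric]
  proof
    assume "F = G * E"
    hence "F * E' = G * (E * E')" by (simp only: mult.assoc)
    then show "F * E' = G" by (simp add: 1)
  next
    assume "F * E' = G"
    hence "G * E = F * E' * E" by simp
    also have "\<dots> = F * (E * E')" by (simp only: mult_ac)
    finally have "G * E = F * (E * E')" .
    then show "F = G * E" by (simp add: 1)
  qed
qed

lemma tree_inverse_compose:
  assumes "F $ 0 = 0"
  shows "tree_inverse oo F = F * (fps_exp 1 oo - F)"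
proof -
  have "fps_exp (- 1) oo F = fps_exp 1 oo (- fps_X oo F)"
    using assms by (subst fps_compose_assoc) simp_all
  with assms show ?thesis
    by (simp add: tree_inverse_def fps_compose_mult_distrib fps_compose_uminus)
qed

lemma tree_equation_iff_cayley: "F = fps_X * (fps_exp 1 oo F) \<longleftrightarrow> F = cayley"
proof
  assume F: "F = fps_X * (fps_exp 1 oo F)"
  \<comment> \<open>The factor \<open>fps_X\<close> forces the constant term to be 0, whatever
    \<open>oo\<close> yields for a series with nonzero constant term.\<close>
  have F0: "F $ 0 = 0" by (subst F) simp
  have "tree_inverse oo F = fps_X"
    using F F0 by (simp add: tree_inverse_compose tree_functional_equation_iff)
  hence "fps_inv tree_inverse oo (tree_inverse oo F) = fps_inv tree_inverse" by simp
  then show "F = cayley"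
    by (simp add: F0 fps_compose_assoc fps_inv cayley_eq_fps_inv)
next
  assume F: "F = cayley"
  hence F0: "F $ 0 = 0" by (simp add: cayley_def)
  have "tree_inverse oo F = fps_X"
    unfolding F cayley_eq_fps_inv by (rule fps_inv_right) simp_all
  then show "F = fps_X * (fps_exp 1 oo F)"
    using F0 by (simp add: tree_inverse_compose tree_functional_equation_iff)
qed

lemma cayley_equation: "cayley = fps_X * (fps_exp 1 oo cayley)"
  by (rule iffD2[OF tree_equation_iff_cayley refl])

lemma cayley_compose_equation:
  assumes "G $ 0 = 0"
  shows "cayley oo G = G * (fps_exp 1 oo (cayley oo G))"
proof -
  have "cayley oo G = (fps_X * (fps_exp 1 oo cayley)) oo G" by (simp only: cayley_equation[symmetric])
  also have "\<dots> = G * (fps_exp 1 oo (cayley oo G))"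
    using assms by (simp add: fps_compose_mult_distrib fps_compose_assoc)
  finally show ?thesis .
qed

section \<open>Closed forms of the two main series and their functional equations\<close>

definition tree_series :: "rat fps" where
  "tree_series = (cayley oo (2 * fps_X)) / 2"

definition red_series :: "rat fps" where
  "red_series = - (cayley oo - tree_series)"

lemma fps_half: "2 * (f / 2) = (f :: rat fps)"
  by (simp add: fps_divide_unit numeral_fps_const fps_const_inverse mult.left_commute)

lemma tree_series_double: "2 * tree_series = cayley oo (2 * fps_X)"
  by (simp add: tree_series_def fps_half)

lemma tree_series_0 [simp]: "tree_series $ 0 = 0"
proof -
  have "(2 * tree_series) $ 0 = 0" unfolding tree_series_double by (simp add: cayley_def)
  then show ?thesis by (simp add: numeral_fps_const)
qed

lemma red_series_0 [simp]: "red_series $ 0 = 0"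
  by (simp add: red_series_def cayley_def)

lemma tree_series_equation: "tree_series = fps_X * (fps_exp 1 oo (2 * tree_series))"
proof -
  have "2 * tree_series = (2 * fps_X) * (fps_exp 1 oo (2 * tree_series))"
    unfolding tree_series_double by (rule cayley_compose_equation) simp
  hence "2 * tree_series = 2 * (fps_X * (fps_exp 1 oo (2 * tree_series)))"
    by (simp only: mult.assoc)
  then show ?thesis by (subst (asm) mult_cancel_left) simp
qed

text \<open>From \<open>- R = C(- T)\<close> the Cayley equation gives
  \<open>- R = - T exp (- R)\<close>. This also identifies the quotient \<open>T / R\<close> in the
  unrooted formula as \<open>exp R\<close>.\<close>

lemma tree_series_eq_red: "tree_series = red_series * (fps_exp 1 oo red_series)"
proof -
  have "- red_series = - tree_series * (fps_exp 1 oo - red_series)"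
    unfolding red_series_def minus_minus by (rule cayley_compose_equation) simp
  hence "- red_series * (fps_exp 1 oo red_series) = - tree_series"
    by (subst (asm) tree_functional_equation_iff) (simp_all only: minus_minus fps_neg_nth red_series_0 neg_equal_zero)
  then show ?thesis by simp
qed

lemma red_series_equation: "red_series = fps_X * (fps_exp 1 oo (2 * tree_series - red_series))"
proof -
  have "red_series = red_series * ((fps_exp 1 oo red_series) * (fps_exp 1 oo - red_series))"
    by (simp add: fps_exp_compose_minus)
  also have "\<dots> = tree_series * (fps_exp 1 oo - red_series)"
    by (simp only: mult.assoc[symmetric] tree_series_eq_red[symmetric])
  also have "\<dots> = fps_X * ((fps_exp 1 oo (2 * tree_series)) * (fps_exp 1 oo - red_series))"
    by (subst tree_series_equation) (simp only: mult.assoc)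
  also have "\<dots> = fps_X * (fps_exp 1 oo (2 * tree_series - red_series))"
    using fps_exp_compose_add[of "2 * tree_series" "- red_series"] by (simp add: numeral_fps_const)
  finally show ?thesis .
qed

section \<open>The Euler operator\<close>

text \<open>Logarithmic differentiation \<open>X f' / f = 1 + X g'\<close> with the denominator
  \<open>f\<close> cleared.\<close>

lemma fps_XD_tree_equation:
  fixes f g :: "rat fps"
  assumes f: "f = fps_X * (fps_exp 1 oo g)" and g: "g $ 0 = 0"
  shows "fps_XD f = f + f * fps_XD g"
proof -
  have "fps_XD f = fps_X * (fps_exp 1 oo g) + (fps_X * (fps_exp 1 oo g)) * (fps_X * fps_deriv g)"
    by (subst f) (simp add: fps_XD_def fps_compose_deriv[OF g] algebra_simps)
  then show ?thesis by (simp only: f[symmetric]) (simp add: fps_XD_def)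
qed

lemma fps_XD_tree_series: "fps_XD tree_series = tree_series + tree_series * fps_XD (2 * tree_series)"
  by (rule fps_XD_tree_equation[OF tree_series_equation]) (simp add: numeral_fps_const)

lemma fps_XD_red_series:
  "fps_XD red_series = red_series + red_series * fps_XD (2 * tree_series - red_series)"
  by (rule fps_XD_tree_equation[OF red_series_equation]) (simp add: numeral_fps_const)

text \<open>The Euler operator \<open>X d/dX\<close> turns the tree equations into linear relations between
  \<open>X T'\<close> and \<open>X R'\<close>, which is how the closed form for the unrooted red series is verified.\<close>

lemma fps_XD_red_unrooted:
  fixes t r u :: "rat fps"
  assumes t: "fps_XD t = t + t * fps_XD (2 * t)"
    and r: "fps_XD r = r + r * fps_XD (2 * t - r)"
    and tr: "t = r * u" and u: "fps_XD u = fps_XD r * u" and r0: "r $ 0 = 0" and t0: "t $ 0 = 0"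
  shows "fps_XD (2 + 2 * t - 2 * t * r + r - 2 * u + r\<^sup>2 / 2) = r"
proof -
  have D_mult: "fps_XD (f * g) = fps_XD f * g + f * fps_XD g" for f g :: "rat fps"
    by (simp add: fps_XD_def algebra_simps)
  have D_diff: "fps_XD (f - g) = fps_XD f - fps_XD g" for f g :: "rat fps"
    by (simp add: fps_XD_def algebra_simps)
  have D_num: "fps_XD (numeral k) = 0" for k
    by (simp add: fps_XD_def)
  have half: "r\<^sup>2 / 2 = fps_const (1/2) * (r * r)"
    by (simp add: fps_divide_unit numeral_fps_const fps_const_inverse power2_eq_square field_simps)
  have hh: "fps_const (1/2) * (f + f) = f" for f :: "rat fps"
    by (rule fps_ext) (simp only: fps_mult_left_const_nth fps_add_nth, simp)
  have D_half: "fps_XD (r\<^sup>2 / 2) = r * fps_XD r"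
  proof -
    have "fps_XD (r\<^sup>2 / 2) = fps_const (1/2) * (fps_XD r * r + r * fps_XD r)"
      unfolding half fps_XD_mult_const unfolding D_mult ..
    also have "fps_XD r * r + r * fps_XD r = r * fps_XD r + r * fps_XD r" by (simp only: mult.commute)
    finally show ?thesis by (simp only: hh)
  qed
  define dt dr where "dt = fps_XD t" and "dr = fps_XD r"
  have dt: "dt * (1 - 2 * t) = t"
    using t unfolding dt_def[symmetric] D_mult D_num by (simp add: algebra_simps)
  have dr: "dr * (1 + r) = r + 2 * r * dt"
    using r unfolding dt_def[symmetric] dr_def[symmetric] D_mult D_num D_diff by (simp add: algebra_simps)
  have "fps_XD (2 + 2 * t - 2 * t * r + r - 2 * u + r\<^sup>2 / 2) =
      2 * dt - 2 * (dt * r + t * dr) + dr - 2 * (dr * u) + r * dr" (is "?L = ?R")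
    unfolding fps_XD_add D_diff D_mult D_num D_half u dt_def dr_def by (simp add: algebra_simps)
  also have "\<dots> = r"
  proof -
    \<comment> \<open>Solving for \<open>dt\<close> and \<open>dr\<close> would divide by
      \<open>1 - 2 * t\<close> and \<open>1 + r\<close>. After multiplication by both, the claim is
      a polynomial consequence of the relations; the product has constant term 1 and
      cancels.\<close>
    have "(1 + r) * (1 - 2 * t) * (?R - r) = 0"
      using dt dr tr by algebra
    moreover have "(1 + r) * (1 - 2 * t) \<noteq> 0"
    proof
      assume "(1 + r) * (1 - 2 * t) = 0"
      moreover have "((1 + r) * (1 - 2 * t)) $ 0 = 1" using r0 t0 by (simp add: numeral_fps_const)
      ultimately show False by (metis fps_zero_nth zero_neq_one)
    qed
    ultimately show ?thesis by simp
  qed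
  finally show ?thesis .
qed

text \<open>\<open>fps_XD\<close> multiplies coefficient \<open>n\<close> by \<open>n\<close>, so it
  forgets exactly the constant term.\<close>

lemma fps_XD_eq_iff:
  fixes f g :: "rat fps"
  assumes "f $ 0 = g $ 0"
  shows "fps_XD f = fps_XD g \<longleftrightarrow> f = g"
proof
  assume *: "fps_XD f = fps_XD g"
  show "f = g"
  proof (rule fps_ext)
    fix n show "f $ n = g $ n"
    proof (cases "n = 0")
      case False
      have "of_nat n * f $ n = of_nat n * g $ n" using arg_cong[OF *, of "\<lambda>h. h $ n"] by simp
      with False show ?thesis by simp
    qed (use assms in simp)
  qed
qed simp

section \<open>Trees as connected digraphs all of whose arcs are bridges\<close>

definition sym_reach :: "('a \<times> 'a) set \<Rightarrow> ('a \<times> 'a) set" where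
  "sym_reach E = (E \<union> E\<inverse>)\<^sup>*"

lemma sym_reach_refl [simp]: "(x, x) \<in> sym_reach E"
  by (simp add: sym_reach_def)

lemma sym_reach_sym: "(x, y) \<in> sym_reach E \<Longrightarrow> (y, x) \<in> sym_reach E"
  unfolding sym_reach_def by (meson sym_Un_converse sym_rtrancl symD)

lemma sym_reach_trans: "(x, y) \<in> sym_reach E \<Longrightarrow> (y, z) \<in> sym_reach E \<Longrightarrow> (x, z) \<in> sym_reach E"
  unfolding sym_reach_def by (rule rtrancl_trans)

lemma sym_reach_arc: "(x, y) \<in> E \<Longrightarrow> (x, y) \<in> sym_reach E"
  unfolding sym_reach_def by blast

lemma sym_reach_arc': "(x, y) \<in> E \<Longrightarrow> (y, x) \<in> sym_reach E"
  unfolding sym_reach_def by blast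

lemma sym_reach_mono: "E \<subseteq> F \<Longrightarrow> (x, y) \<in> sym_reach E \<Longrightarrow> (x, y) \<in> sym_reach F"
  unfolding sym_reach_def using rtrancl_mono[of "E \<union> E\<inverse>" "F \<union> F\<inverse>"] by blast

lemma sym_reach_induct [consumes 1, case_names refl step, induct pred: sym_reach]:
  assumes "(x, y) \<in> sym_reach E" "P x"
    and "\<And>y z. (x, y) \<in> sym_reach E \<Longrightarrow> (y, z) \<in> E \<or> (z, y) \<in> E \<Longrightarrow> P y \<Longrightarrow> P z"
  shows "P y"
  using assms(1) unfolding sym_reach_def
proof (induction rule: rtrancl_induct)
  case (step y z)
  then show ?case using assms(3)[of y z] by (auto simp: sym_reach_def)
qed (rule assms(2))

lemma sym_reach_closed:
  assumes "(x, y) \<in> sym_reach E" "x \<in> S" "\<And>a b. (a, b) \<in> E \<Longrightarrow> a \<in> S \<longleftrightarrow> b \<in> S"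
  shows "y \<in> S"
  using assms(1) by (induction rule: sym_reach_induct) (use assms in auto)

text \<open>Every arc being a bridge of the underlying undirected multigraph excludes loops and pairs of
  opposite arcs as well as longer cycles.\<close>

definition dtree :: "'a set \<Rightarrow> ('a \<times> 'a) set \<Rightarrow> bool" where
  "dtree V E \<longleftrightarrow> finite V \<and> V \<noteq> {} \<and> E \<subseteq> V \<times> V \<and> (\<forall>x\<in>V. \<forall>y\<in>V. (x, y) \<in> sym_reach E) \<and>
     (\<forall>e\<in>E. e \<notin> sym_reach (E - {e}))"

lemma dtree_neq: "dtree V E \<Longrightarrow> (a, b) \<in> E \<Longrightarrow> a \<noteq> b"
  unfolding dtree_def by fastforce

section \<open>Joining two trees by an arc\<close>

text \<open>Collapsing \<open>V2\<close> onto the end of the linking arc in \<open>V1\<close> maps a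
  walk of the union to a walk in \<open>E1\<close>, since \<open>V1\<close> can be left and
  reentered only through that vertex.\<close>

lemma sym_reach_retract:
  assumes "(a, y) \<in> sym_reach (insert (v, w) (E1 \<union> E2))" "a \<in> V1"
    and "E1 \<subseteq> V1 \<times> V1" "E2 \<subseteq> V2 \<times> V2" "V1 \<inter> V2 = {}" "(v \<in> V1 \<and> w \<in> V2) \<or> (v \<in> V2 \<and> w \<in> V1)"
  shows "(y \<in> V1 \<and> (a, y) \<in> sym_reach E1) \<or> (y \<in> V2 \<and> (a, if v \<in> V1 then v else w) \<in> sym_reach E1)"
  using assms(1)
proof (induction rule: sym_reach_induct)
  case refl
  then show ?case using assms(2) by simp
next
  case (step y z)
  then show ?case using assms(2-)
    by (auto split: if_splits dest: sym_reach_arc sym_reach_arc' intro: sym_reach_trans)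
qed

text \<open>A bypass of \<open>e\<close> in the joined graph retracts to a bypass inside
  \<open>E1\<close>. The symmetric assumption on \<open>v\<close> and \<open>w\<close> lets the
  argument serve the arcs of either part.\<close>

lemma dtree_join_bridge:
  assumes "dtree V1 E1" "dtree V2 E2" "V1 \<inter> V2 = {}" "(v \<in> V1 \<and> w \<in> V2) \<or> (v \<in> V2 \<and> w \<in> V1)"
    and e: "e \<in> E1"
  shows "e \<notin> sym_reach (insert (v, w) (E1 \<union> E2) - {e})"
proof
  assume *: "e \<in> sym_reach (insert (v, w) (E1 \<union> E2) - {e})"
  obtain a b where ab: "e = (a, b)" by (cases e)
  have E: "E1 \<subseteq> V1 \<times> V1" "E2 \<subseteq> V2 \<times> V2" using assms by (auto simp: dtree_def)
  have "(a, b) \<in> sym_reach (insert (v, w) ((E1 - {e}) \<union> E2))"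
    using * unfolding ab by (rule sym_reach_mono[rotated]) auto
  from sym_reach_retract[OF this, of V1 V2] have "(a, b) \<in> sym_reach (E1 - {e})"
    using E e assms(3,4) unfolding ab by auto
  then show False using assms(1) e unfolding ab dtree_def by blast
qed

lemma dtree_join:
  assumes t1: "dtree V1 E1" and t2: "dtree V2 E2" and disj: "V1 \<inter> V2 = {}" and vw: "v \<in> V1" "w \<in> V2"
  shows "dtree (V1 \<union> V2) (insert (v, w) (E1 \<union> E2))" (is "dtree ?V ?E")
proof -
  have E: "E1 \<subseteq> V1 \<times> V1" "E2 \<subseteq> V2 \<times> V2" using assms by (auto simp: dtree_def)
  have c1: "(v, x) \<in> sym_reach ?E" if "x \<in> V1" for x
    using that t1 vw by (intro sym_reach_mono[of E1 ?E]) (auto simp: dtree_def)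
  have c2: "(w, x) \<in> sym_reach ?E" if "x \<in> V2" for x
    using that t2 vw by (intro sym_reach_mono[of E2 ?E]) (auto simp: dtree_def)
  have c: "(v, x) \<in> sym_reach ?E" if "x \<in> ?V" for x
    using that c1 c2 sym_reach_trans[OF sym_reach_arc[of v w ?E]] by blast
  \<comment> \<open>Without the new arc, \<open>V1\<close> is closed and separates \<open>v\<close>
    from \<open>w\<close>.\<close>
  have b0: "(v, w) \<notin> sym_reach (?E - {(v, w)})"
  proof
    assume "(v, w) \<in> sym_reach (?E - {(v, w)})"
    then have "w \<in> V1" by (rule sym_reach_closed) (use E disj vw in auto)
    with vw disj show False by auto
  qed
  have b1: "e \<notin> sym_reach (?E - {e})" if "e \<in> E1" for e
    using dtree_join_bridge[OF t1 t2 disj _ that] vw by blast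
  have b2: "e \<notin> sym_reach (?E - {e})" if "e \<in> E2" for e
    using dtree_join_bridge[OF t2 t1 _ _ that, of v w] vw disj by (auto simp: Un_commute)
  have "\<forall>x\<in>?V. \<forall>y\<in>?V. (x, y) \<in> sym_reach ?E"
    using c sym_reach_sym sym_reach_trans by metis
  then show ?thesis
    using b0 b1 b2 t1 t2 vw E unfolding dtree_def by auto
qed

section \<open>Cutting a tree at an arc\<close>

lemma sym_reach_restrict:
  assumes "(a, y) \<in> sym_reach E" "a \<in> S" "\<And>a b. (a, b) \<in> E \<Longrightarrow> a \<in> S \<longleftrightarrow> b \<in> S"
  shows "(a, y) \<in> sym_reach (E \<inter> S \<times> S)"
proof -
  have "y \<in> S \<and> (a, y) \<in> sym_reach (E \<inter> S \<times> S)"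
    using assms(1)
  proof (induction rule: sym_reach_induct)
    case (step y z)
    then have "(y, z) \<in> sym_reach (E \<inter> S \<times> S)" "z \<in> S"
      using assms(3) by (auto intro: sym_reach_arc sym_reach_arc')
    with step show ?case by (blast intro: sym_reach_trans)
  qed (use assms in auto)
  then show ?thesis ..
qed

text \<open>No remaining arc crosses the boundary of \<open>S\<close>, which gives connectedness,
  and a bypass in the subgraph would be a bypass in \<open>E\<close>. With \<open>c\<close> free,
  both sides of the cut are covered.\<close>

lemma dtree_part:
  assumes t: "dtree V E" and e: "(a, b) \<in> E" and S: "S = {x\<in>V. (c, x) \<in> sym_reach (E - {(a, b)})}" and "c \<in> V"
  shows "dtree S (E \<inter> S \<times> S)"
proof -
  let ?F = "E - {(a, b)}"
  have EV: "E \<subseteq> V \<times> V" using t by (auto simp: dtree_def)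
  have cl: "x \<in> S \<longleftrightarrow> y \<in> S" if "(x, y) \<in> ?F" for x y
    using that EV unfolding S by (blast intro: sym_reach_trans sym_reach_arc sym_reach_arc')
  have "(x, y) \<in> sym_reach (E \<inter> S \<times> S)" if "x \<in> S" "y \<in> S" for x y
  proof -
    have "(x, y) \<in> sym_reach ?F" using that unfolding S by (blast intro: sym_reach_sym sym_reach_trans)
    from sym_reach_restrict[OF this \<open>x \<in> S\<close> cl] show ?thesis
      by (rule sym_reach_mono[rotated]) auto
  qed
  moreover have "f \<notin> sym_reach (E \<inter> S \<times> S - {f})" if "f \<in> E \<inter> S \<times> S" for f
  proof
    assume "f \<in> sym_reach (E \<inter> S \<times> S - {f})"
    then have "f \<in> sym_reach (E - {f})"
      using sym_reach_mono[of "E \<inter> S \<times> S - {f}" "E - {f}" "fst f" "snd f"] by auto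
    with t that show False by (auto simp: dtree_def)
  qed
  moreover have "c \<in> S" using \<open>c \<in> V\<close> by (simp add: S)
  moreover have "finite S" using t unfolding S dtree_def by simp
  ultimately show ?thesis unfolding dtree_def by auto
qed

lemma dtree_split:
  assumes t: "dtree V E" and e: "(a, b) \<in> E"
  defines "S \<equiv> {x\<in>V. (b, x) \<in> sym_reach (E - {(a, b)})}"
  shows "dtree S (E \<inter> S \<times> S)" "dtree (V - S) (E \<inter> (V - S) \<times> (V - S))"
    "a \<in> V - S" "b \<in> S" "E = insert (a, b) (E \<inter> (V - S) \<times> (V - S) \<union> E \<inter> S \<times> S)"
proof -
  let ?F = "E - {(a, b)}"
  have EV: "E \<subseteq> V \<times> V" using t by (auto simp: dtree_def)
  with e have ab: "a \<in> V" "b \<in> V" by auto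
  have br: "(a, b) \<notin> sym_reach ?F" using t e by (auto simp: dtree_def)
  \<comment> \<open>A step along the deleted arc lands in \<open>a\<close> or \<open>b\<close>,
    where the walk can be restarted.\<close>
  have cov: "(a, x) \<in> sym_reach ?F \<or> (b, x) \<in> sym_reach ?F" if "x \<in> V" for x
  proof -
    have "(a, x) \<in> sym_reach E" using t ab that by (auto simp: dtree_def)
    then show ?thesis
    proof (induction rule: sym_reach_induct)
      case (step y z)
      show ?case
      proof (cases "(y, z) = (a, b) \<or> (z, y) = (a, b)")
        case False
        with step.hyps have "(y, z) \<in> sym_reach ?F" by (auto intro: sym_reach_arc sym_reach_arc')
        with step.IH show ?thesis by (blast intro: sym_reach_trans)
      qed auto
    qed simp
  qed
  have VS: "V - S = {x\<in>V. (a, x) \<in> sym_reach ?F}"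
    unfolding S_def using cov br by (blast intro: sym_reach_trans sym_reach_sym)
  show "dtree S (E \<inter> S \<times> S)" by (rule dtree_part[OF t e _ ab(2)]) (simp add: S_def)
  show "dtree (V - S) (E \<inter> (V - S) \<times> (V - S))" by (rule dtree_part[OF t e _ ab(1)]) (simp add: VS)
  show "a \<in> V - S" "b \<in> S" unfolding VS unfolding S_def using ab by auto
  have "x \<in> S \<longleftrightarrow> y \<in> S" if "(x, y) \<in> ?F" for x y
    using that EV unfolding S_def by (blast intro: sym_reach_trans sym_reach_arc sym_reach_arc')
  then show "E = insert (a, b) (E \<inter> (V - S) \<times> (V - S) \<union> E \<inter> S \<times> S)"
    using EV e by blast
qed

section \<open>Branches at a root, for both orientations of the linking arc\<close>

definition arrow :: "bool \<Rightarrow> 'a \<Rightarrow> 'a \<Rightarrow> 'a \<times> 'a" where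
  "arrow d v w = (if d then (v, w) else (w, v))"

lemma arrow_simps [simp]: "arrow True v w = (v, w)" "arrow False v w = (w, v)"
  by (simp_all add: arrow_def)

lemma dtree_join_arrow:
  assumes "dtree V1 E1" "dtree V2 E2" "V1 \<inter> V2 = {}" "v \<in> V1" "w \<in> V2"
  shows "dtree (V1 \<union> V2) (insert (arrow d v w) (E1 \<union> E2))"
  using dtree_join[OF assms] dtree_join[OF assms(2,1) _ assms(5,4)] assms(3)
  by (cases d) (auto simp: Un_commute Int_commute)

lemma dtree_split_arrow:
  assumes t: "dtree V E" and "arrow d v w \<in> E"
  obtains S where "dtree S (E \<inter> S \<times> S)" "dtree (V - S) (E \<inter> (V - S) \<times> (V - S))" "S \<subseteq> V"
    "v \<in> V - S" "w \<in> S" "E = insert (arrow d v w) (E \<inter> (V - S) \<times> (V - S) \<union> E \<inter> S \<times> S)"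
    "\<And>x. x \<in> V \<Longrightarrow> (w, x) \<in> sym_reach (E - {arrow d v w}) \<Longrightarrow> x \<in> S"
proof (cases d)
  case True
  then have e: "(v, w) \<in> E" using assms by simp
  note s = dtree_split[OF t e]
  show ?thesis
  proof (rule that[of "{x\<in>V. (w, x) \<in> sym_reach (E - {(v, w)})}"])
    show "E = insert (arrow d v w) (E \<inter> (V - {x\<in>V. (w, x) \<in> sym_reach (E - {(v, w)})}) \<times>
        (V - {x\<in>V. (w, x) \<in> sym_reach (E - {(v, w)})}) \<union>
        E \<inter> {x\<in>V. (w, x) \<in> sym_reach (E - {(v, w)})} \<times> {x\<in>V. (w, x) \<in> sym_reach (E - {(v, w)})})"
      using s(5) True by simp
  qed (use s True in auto)
next
  case False
  then have e: "(w, v) \<in> E" using assms by simp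
  \<comment> \<open>For the reversed arc the set from \<open>dtree_split\<close> is the side of
    \<open>v\<close>; the branch is its complement.\<close>
  let ?S = "{x\<in>V. (v, x) \<in> sym_reach (E - {(w, v)})}"
  note s = dtree_split[OF t e]
  have VV: "V - (V - ?S) = ?S" by auto
  show ?thesis
  proof (rule that[of "V - ?S"], unfold VV)
    show "E = insert (arrow d v w) (E \<inter> ?S \<times> ?S \<union> E \<inter> (V - ?S) \<times> (V - ?S))"
      using s(5) False by (simp add: Un_commute)
    fix x assume "x \<in> V" "(w, x) \<in> sym_reach (E - {arrow d v w})"
    then show "x \<in> V - ?S"
      using t e False by (auto simp: dtree_def dest: sym_reach_sym intro: sym_reach_trans)
        (metis sym_reach_sym sym_reach_trans)
  qed (use s in auto)
qed

text \<open>The branch is the one entered at the last departure from \<open>v\<close> of a walk to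
  \<open>x\<close>; the induction along the walk makes a new choice after each visit to
  \<open>v\<close>.\<close>

lemma dtree_branch:
  assumes t: "dtree V E" and "v \<in> V" "x \<in> V" "x \<noteq> v"
  obtains d w where "arrow d v w \<in> E" "(w, x) \<in> sym_reach (E - {arrow d v w})"
proof -
  have "(v, x) \<in> sym_reach E" using assms by (auto simp: dtree_def)
  then have "x \<noteq> v \<longrightarrow> (\<exists>d w. arrow d v w \<in> E \<and> (w, x) \<in> sym_reach (E - {arrow d v w}))"
  proof (induction rule: sym_reach_induct)
    case (step y z)
    show ?case
    proof
      assume z: "z \<noteq> v"
      show "\<exists>d w. arrow d v w \<in> E \<and> (w, z) \<in> sym_reach (E - {arrow d v w})"
      proof (cases "y = v")
        case True
        with step.hyps have "arrow True v z \<in> E \<or> arrow False v z \<in> E" by auto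
        then show ?thesis by (metis sym_reach_refl)
      next
        case False
        with step.IH obtain d w where dw: "arrow d v w \<in> E" "(w, y) \<in> sym_reach (E - {arrow d v w})"
          by blast
        \<comment> \<open>The deleted arc is incident with \<open>v\<close>, while \<open>y\<close>
          and \<open>z\<close> both differ from \<open>v\<close>.\<close>
        have "(y, z) \<in> sym_reach (E - {arrow d v w})"
          using step.hyps False z by (cases d) (auto intro: sym_reach_arc sym_reach_arc')
        with dw show ?thesis by (blast intro: sym_reach_trans)
      qed
    qed
  qed simp
  with assms that show ?thesis by blast
qed

text \<open>Walks inside \<open>S\<close> avoid \<open>v\<close>, hence also the arc linking
  \<open>v\<close> to \<open>w'\<close>, and no other arc crosses the boundary of \<open>S'\<close>.
  Starting at the common vertex \<open>x\<close>, they stay in \<open>S'\<close>.\<close>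

lemma dtree_branch_subset:
  assumes E: "insert (arrow d v w) (E1 \<union> E2) = insert (arrow d' v w') (E1' \<union> E2')"
    and t: "dtree S E2" and x: "x \<in> S" "x \<in> S'" and v: "v \<notin> S"
    and E': "E1' \<subseteq> (V - S') \<times> (V - S')" "E2' \<subseteq> S' \<times> S'"
  shows "S \<subseteq> S'"
proof
  fix y assume "y \<in> S"
  have "E2 \<subseteq> S \<times> S" using t by (simp add: dtree_def)
  hence "arrow d' v w' \<notin> E2" using v by (cases d') auto
  have cl: "a \<in> S' \<longleftrightarrow> b \<in> S'" if "(a, b) \<in> E2" for a b
  proof -
    have "(a, b) \<in> insert (arrow d' v w') (E1' \<union> E2')" unfolding E[symmetric] using that by blast
    moreover have "(a, b) \<noteq> arrow d' v w'" using that \<open>arrow d' v w' \<notin> E2\<close> by metis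
    ultimately show ?thesis using E' by blast
  qed
  have "(x, y) \<in> sym_reach E2" using t x \<open>y \<in> S\<close> by (simp add: dtree_def)
  then show "y \<in> S'" by (rule sym_reach_closed) (use x cl in auto)
qed

text \<open>Two branches with a common vertex contain each other. The linking arc is then the only
  arc across the boundary, which fixes its direction, its end and both arc sets.\<close>

lemma dtree_branch_unique:
  assumes E: "insert (arrow d v w) (E1 \<union> E2) = insert (arrow d' v w') (E1' \<union> E2')"
    and t: "dtree (V - S) E1" "dtree S E2" "dtree (V - S') E1'" "dtree S' E2'"
    and x: "x \<in> S" "x \<in> S'" and v: "v \<in> V - S" "v \<in> V - S'" "w \<in> S" "w' \<in> S'"
  shows "S = S' \<and> d = d' \<and> w = w' \<and> E1 = E1' \<and> E2 = E2'"
proof -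
  have sub: "E1 \<subseteq> (V - S) \<times> (V - S)" "E2 \<subseteq> S \<times> S" "E1' \<subseteq> (V - S') \<times> (V - S')" "E2' \<subseteq> S' \<times> S'"
    using t by (auto simp: dtree_def)
  have S: "S = S'"
    using dtree_branch_subset[OF E t(2) x _ sub(3,4)] dtree_branch_subset[OF E[symmetric] t(4) x(2,1) _ sub(1,2)] v
    by blast
  have "arrow d v w \<notin> E1' \<union> E2'" using sub v unfolding S by (cases d) auto
  with E have a: "arrow d v w = arrow d' v w'" by blast
  with v S have dw: "d = d' \<and> w = w'" by (auto simp: arrow_def split: if_splits)
  have "arrow d v w \<notin> E1 \<union> E2" using sub v by (cases d) auto
  with \<open>arrow d v w \<notin> E1' \<union> E2'\<close> E a have "E1 \<union> E2 = E1' \<union> E2'" by (metis insert_ident)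
  with sub S have "E1 = E1' \<and> E2 = E2'" by blast
  with S dw show ?thesis by blast
qed

section \<open>Counting colored trees by cutting off a branch\<close>

definition has_red :: "('a \<times> 'a) set \<Rightarrow> 'a set \<Rightarrow> 'a \<Rightarrow> bool" where
  "has_red E K u \<longleftrightarrow> (\<exists>z. (u, z) \<in> E \<and> z \<in> K)"

text \<open>Rooted trees \<open>(E, v, K)\<close> with red set \<open>K\<close> that satisfy the coloring rule everywhere except
  possibly at the root \<open>v\<close>; \<open>\<Phi>\<close> restricts whether the root is red and whether it has a red child.\<close>

definition colored_trees :: "(bool \<Rightarrow> bool \<Rightarrow> bool) \<Rightarrow> 'a set \<Rightarrow> (('a \<times> 'a) set \<times> 'a \<times> 'a set) set" where
  "colored_trees \<Phi> V = {(E, v, K). dtree V E \<and> v \<in> V \<and> K \<subseteq> V \<and>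
     (\<forall>u\<in>V - {v}. u \<in> K \<longleftrightarrow> \<not> has_red E K u) \<and> \<Phi> (v \<in> K) (has_red E K v)}"

lemma colored_trees_empty [simp]: "colored_trees \<Phi> {} = {}"
  by (auto simp: colored_trees_def)

lemma finite_colored_trees [simp]: "finite V \<Longrightarrow> finite (colored_trees \<Phi> V)"
  by (rule finite_subset[of _ "Pow (V \<times> V) \<times> V \<times> Pow V"]) (auto simp: colored_trees_def dtree_def)

text \<open>Joining alters \<open>has_red\<close> only at the ends of the new arc, so everything
  reduces to the Boolean condition \<open>compat\<close>. There \<open>k1\<close>, \<open>s1\<close>
  stand for \<open>v\<close> being red and having a red child before the join, \<open>k2\<close>,
  \<open>s2\<close> for the same at \<open>w\<close>; \<open>\<Psi>\<close> is what the join demands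
  of the branch root.\<close>

lemma colored_trees_join_iff:
  assumes t: "dtree V1 E1" "dtree V2 E2" and disj: "V1 \<inter> V2 = {}" and vw: "v \<in> V1" "w \<in> V2"
    and K: "K1 \<subseteq> V1" "K2 \<subseteq> V2"
    and compat: "\<And>k1 s1 k2 s2. (k2 \<longleftrightarrow> \<not> (s2 \<or> (\<not> d \<and> k1))) \<and> \<Phi> k1 (s1 \<or> (d \<and> k2)) \<longleftrightarrow>
      \<Phi> k1 s1 \<and> \<Psi> k2 s2"
  shows "(insert (arrow d v w) (E1 \<union> E2), v, K1 \<union> K2) \<in> colored_trees \<Phi> (V1 \<union> V2) \<longleftrightarrow>
    (E1, v, K1) \<in> colored_trees \<Phi> V1 \<and> (E2, w, K2) \<in> colored_trees \<Psi> V2"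
proof -
  let ?E = "insert (arrow d v w) (E1 \<union> E2)" and ?K = "K1 \<union> K2"
  have sub: "E1 \<subseteq> V1 \<times> V1" "E2 \<subseteq> V2 \<times> V2" using t by (auto simp: dtree_def)
  have tj: "dtree (V1 \<union> V2) ?E" using t disj vw by (rule dtree_join_arrow)
  have h1: "has_red ?E ?K u = has_red E1 K1 u" if "u \<in> V1" "u \<noteq> v" for u
    using that sub K disj vw unfolding has_red_def by (cases d) auto
  have h2: "has_red ?E ?K u = has_red E2 K2 u" if "u \<in> V2" "u \<noteq> w" for u
    using that sub K disj vw unfolding has_red_def by (cases d) auto
  have hv: "has_red ?E ?K v = (has_red E1 K1 v \<or> (d \<and> w \<in> K2))"
    using sub K disj vw unfolding has_red_def by (cases d) auto
  have hw: "has_red ?E ?K w = (has_red E2 K2 w \<or> (\<not> d \<and> v \<in> K1))"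
    using sub K disj vw unfolding has_red_def by (cases d) auto
  have k: "u \<in> ?K \<longleftrightarrow> u \<in> K1" if "u \<in> V1" for u using that K disj by auto
  have k': "u \<in> ?K \<longleftrightarrow> u \<in> K2" if "u \<in> V2" for u using that K disj by auto
  \<comment> \<open>As root of its branch \<open>w\<close> was exempt from the coloring rule; in the
    joined tree it must obey it.\<close>
  have V: "V1 \<union> V2 - {v} = insert w ((V1 - {v}) \<union> (V2 - {w}))" using disj vw by auto
  have "(?E, v, ?K) \<in> colored_trees \<Phi> (V1 \<union> V2) \<longleftrightarrow>
      (\<forall>u\<in>V1 - {v}. u \<in> K1 \<longleftrightarrow> \<not> has_red E1 K1 u) \<and> (\<forall>u\<in>V2 - {w}. u \<in> K2 \<longleftrightarrow> \<not> has_red E2 K2 u) \<and>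
      (w \<in> K2 \<longleftrightarrow> \<not> (has_red E2 K2 w \<or> (\<not> d \<and> v \<in> K1))) \<and>
      \<Phi> (v \<in> K1) (has_red E1 K1 v \<or> (d \<and> w \<in> K2))"
  proof -
    have a: "(\<forall>u\<in>V1 - {v}. u \<in> ?K \<longleftrightarrow> \<not> has_red ?E ?K u) \<longleftrightarrow>
        (\<forall>u\<in>V1 - {v}. u \<in> K1 \<longleftrightarrow> \<not> has_red E1 K1 u)"
    proof (rule ball_cong[OF refl])
      fix u assume "u \<in> V1 - {v}"
      then have "u \<in> V1" "u \<noteq> v" by auto
      then show "(u \<in> ?K \<longleftrightarrow> \<not> has_red ?E ?K u) \<longleftrightarrow> (u \<in> K1 \<longleftrightarrow> \<not> has_red E1 K1 u)"
        by (simp only: h1[OF \<open>u \<in> V1\<close> \<open>u \<noteq> v\<close>] k)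
    qed
    have b: "(\<forall>u\<in>V2 - {w}. u \<in> ?K \<longleftrightarrow> \<not> has_red ?E ?K u) \<longleftrightarrow>
        (\<forall>u\<in>V2 - {w}. u \<in> K2 \<longleftrightarrow> \<not> has_red E2 K2 u)"
    proof (rule ball_cong[OF refl])
      fix u assume "u \<in> V2 - {w}"
      then have "u \<in> V2" "u \<noteq> w" by auto
      then show "(u \<in> ?K \<longleftrightarrow> \<not> has_red ?E ?K u) \<longleftrightarrow> (u \<in> K2 \<longleftrightarrow> \<not> has_red E2 K2 u)"
        by (simp only: h2[OF \<open>u \<in> V2\<close> \<open>u \<noteq> w\<close>] k')
    qed
    have "(?E, v, ?K) \<in> colored_trees \<Phi> (V1 \<union> V2) \<longleftrightarrow>
        (\<forall>u\<in>V1 \<union> V2 - {v}. u \<in> ?K \<longleftrightarrow> \<not> has_red ?E ?K u) \<and> \<Phi> (v \<in> ?K) (has_red ?E ?K v)"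
      unfolding colored_trees_def using tj vw K by blast
    then show ?thesis
      by (simp only: V ball_simps(7) ball_Un a b hv hw k[OF vw(1)] k'[OF vw(2)] conj_ac)
  qed
  also have "\<dots> \<longleftrightarrow> (\<forall>u\<in>V1 - {v}. u \<in> K1 \<longleftrightarrow> \<not> has_red E1 K1 u) \<and>
      (\<forall>u\<in>V2 - {w}. u \<in> K2 \<longleftrightarrow> \<not> has_red E2 K2 u) \<and>
      \<Phi> (v \<in> K1) (has_red E1 K1 v) \<and> \<Psi> (w \<in> K2) (has_red E2 K2 w)"
    unfolding compat ..
  also have "\<dots> \<longleftrightarrow> (E1, v, K1) \<in> colored_trees \<Phi> V1 \<and> (E2, w, K2) \<in> colored_trees \<Psi> V2"
    using t vw K by (auto simp: colored_trees_def)
  finally show ?thesis .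
qed

text \<open>A marked vertex \<open>x\<close> other than the root selects the branch \<open>S\<close> at the root that contains it.\<close>

lemma bij_betw_colored_trees_join:
  fixes V :: "'a set"
  assumes "finite V"
    and compat: "\<And>d k1 s1 k2 s2. (k2 \<longleftrightarrow> \<not> (s2 \<or> (\<not> d \<and> k1))) \<and> \<Phi> k1 (s1 \<or> (d \<and> k2)) \<longleftrightarrow>
      \<Phi> k1 s1 \<and> \<Psi> d k2 s2"
  shows "bij_betw (\<lambda>(S, (E1, v, K1), (d, E2, w, K2), x).
        ((insert (arrow d v w) (E1 \<union> E2), v, K1 \<union> K2), x))
      (SIGMA S:Pow V. colored_trees \<Phi> (V - S) \<times> (SIGMA d:UNIV. colored_trees (\<Psi> d) S) \<times> S)
      (SIGMA p:colored_trees \<Phi> V. V - {fst (snd p)})" (is "bij_betw ?J ?N ?M")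
  unfolding bij_betw_def
proof
  note cj = colored_trees_join_iff[of _ _ _ _ _ _ _ _ _ \<Phi> "\<Psi> _", OF _ _ _ _ _ _ _ compat]
  show "inj_on ?J ?N"
  proof (rule inj_onI)
    fix p q assume p: "p \<in> ?N" and q: "q \<in> ?N" and eq: "?J p = ?J q"
    obtain S E1 v K1 d E2 w K2 x where p': "p = (S, (E1, v, K1), (d, E2, w, K2), x)"
      by (metis surj_pair)
    obtain S' E1' v' K1' d' E2' w' K2' x' where q': "q = (S', (E1', v', K1'), (d', E2', w', K2'), x')"
      by (metis surj_pair)
    have e: "insert (arrow d v w) (E1 \<union> E2) = insert (arrow d' v w') (E1' \<union> E2')"
      "v' = v" "x' = x" "K1 \<union> K2 = K1' \<union> K2'"
      using eq unfolding p' q' by auto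
    have P: "dtree (V - S) E1" "dtree S E2" "v \<in> V - S" "w \<in> S" "x \<in> S" "K1 \<subseteq> V - S" "K2 \<subseteq> S"
      using p unfolding p' colored_trees_def by auto
    have Q: "dtree (V - S') E1'" "dtree S' E2'" "v \<in> V - S'" "w' \<in> S'" "x \<in> S'" "K1' \<subseteq> V - S'" "K2' \<subseteq> S'"
      using q e unfolding q' colored_trees_def by auto
    have *: "S = S' \<and> d = d' \<and> w = w' \<and> E1 = E1' \<and> E2 = E2'"
      by (rule dtree_branch_unique[OF e(1) P(1,2) Q(1,2) P(5) Q(5) P(3) Q(3) P(4) Q(4)])
    have "K1 = K1' \<and> K2 = K2'" using P(6,7) Q(6,7) e(4) * by blast
    with * e show "p = q" unfolding p' q' by simp
  qed
  show "?J ` ?N = ?M"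
  proof (intro subset_antisym subsetI)
    fix q assume "q \<in> ?J ` ?N"
    then obtain S E1 v K1 d E2 w K2 x where q: "q = ((insert (arrow d v w) (E1 \<union> E2), v, K1 \<union> K2), x)"
      and S: "S \<subseteq> V" and m: "(E1, v, K1) \<in> colored_trees \<Phi> (V - S)" "(E2, w, K2) \<in> colored_trees (\<Psi> d) S" and x: "x \<in> S"
      by fastforce
    have "(insert (arrow d v w) (E1 \<union> E2), v, K1 \<union> K2) \<in> colored_trees \<Phi> ((V - S) \<union> S)"
      by (subst cj) (use m in \<open>auto simp: colored_trees_def\<close>)
    moreover have "(V - S) \<union> S = V" using S by blast
    moreover have "x \<noteq> v" "x \<in> V" using x S m by (auto simp: colored_trees_def)
    ultimately show "q \<in> ?M" unfolding q by simp
  next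
    fix q assume qM: "q \<in> ?M"
    obtain E v K x where q: "q = ((E, v, K), x)" by (metis surj_pair)
    have m: "(E, v, K) \<in> colored_trees \<Phi> V" and x: "x \<in> V" "x \<noteq> v"
      using qM unfolding q by auto
    have t: "dtree V E" and v: "v \<in> V" and K: "K \<subseteq> V" using m by (auto simp: colored_trees_def)
    obtain d w where dw: "arrow d v w \<in> E" "(w, x) \<in> sym_reach (E - {arrow d v w})"
      using dtree_branch[OF t v x] .
    obtain S where S: "dtree S (E \<inter> S \<times> S)" "dtree (V - S) (E \<inter> (V - S) \<times> (V - S))" "S \<subseteq> V"
      "v \<in> V - S" "w \<in> S" "E = insert (arrow d v w) (E \<inter> (V - S) \<times> (V - S) \<union> E \<inter> S \<times> S)" "x \<in> S"
      using dtree_split_arrow[OF t dw(1)] dw(2) x(1) by metis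
    let ?E1 = "E \<inter> (V - S) \<times> (V - S)" and ?E2 = "E \<inter> S \<times> S" and ?K1 = "K \<inter> (V - S)" and ?K2 = "K \<inter> S"
    have KK: "?K1 \<union> ?K2 = K" and VV: "(V - S) \<union> S = V" using K S(3) by auto
    have "(E, v, K) = (insert (arrow d v w) (?E1 \<union> ?E2), v, ?K1 \<union> ?K2)" using S(6) KK by simp
    then have "(insert (arrow d v w) (?E1 \<union> ?E2), v, ?K1 \<union> ?K2) \<in> colored_trees \<Phi> ((V - S) \<union> S)"
      using m VV by simp
    then have "(?E1, v, ?K1) \<in> colored_trees \<Phi> (V - S) \<and> (?E2, w, ?K2) \<in> colored_trees (\<Psi> d) S"
      by (subst (asm) cj) (use S in auto)
    then have "(S, (?E1, v, ?K1), (d, ?E2, w, ?K2), x) \<in> ?N" using S by auto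
    moreover have "q = ?J (S, (?E1, v, ?K1), (d, ?E2, w, ?K2), x)"
      using S(6) KK by (simp add: q)
    ultimately show "q \<in> ?J ` ?N" by blast
  qed
qed

section \<open>The recurrence and its solution by power series\<close>

text \<open>Double counting of trees with a marked vertex other than the root: \<open>card S\<close>
  counts the marks within a branch and the inner sum the orientations of its arc. The extreme
  subsets \<open>{}\<close> and \<open>V\<close> contribute nothing, as an empty set carries no
  tree.\<close>

lemma card_colored_trees_recurrence:
  fixes V :: "'a set"
  assumes V: "finite V"
    and compat: "\<And>d k1 s1 k2 s2. (k2 \<longleftrightarrow> \<not> (s2 \<or> (\<not> d \<and> k1))) \<and> \<Phi> k1 (s1 \<or> (d \<and> k2)) \<longleftrightarrow>
      \<Phi> k1 s1 \<and> \<Psi> d k2 s2"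
  shows "(card V - 1) * card (colored_trees \<Phi> V) = (\<Sum>S\<in>Pow V. card (colored_trees \<Phi> (V - S)) *
     ((card (colored_trees (\<Psi> True) S) + card (colored_trees (\<Psi> False) S)) * card S))"
proof -
  have "card (SIGMA p:colored_trees \<Phi> V. V - {fst (snd p)}) = (\<Sum>p\<in>colored_trees \<Phi> V. card (V - {fst (snd p)}))"
    using V by (intro card_SigmaI) auto
  also have "\<dots> = (\<Sum>p\<in>colored_trees \<Phi> V. card V - 1)"
    using V by (intro sum.cong refl card_Diff_singleton) (auto simp: colored_trees_def)
  finally have "(card V - 1) * card (colored_trees \<Phi> V) = card (SIGMA p:colored_trees \<Phi> V. V - {fst (snd p)})"
    by (simp add: mult.commute)
  also have "\<dots> = card (SIGMA S:Pow V. colored_trees \<Phi> (V - S) \<times> (SIGMA d:UNIV. colored_trees (\<Psi> d) S) \<times> S)"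
    using bij_betw_same_card[OF bij_betw_colored_trees_join[OF V compat]] by simp
  also have "\<dots> = (\<Sum>S\<in>Pow V. card (colored_trees \<Phi> (V - S) \<times> (SIGMA d:UNIV. colored_trees (\<Psi> d) S) \<times> S))"
    using V by (intro card_SigmaI) (auto intro!: finite_cartesian_product finite_SigmaI finite_colored_trees intro: finite_subset)
  also have "\<dots> = (\<Sum>S\<in>Pow V. card (colored_trees \<Phi> (V - S)) *
     ((card (colored_trees (\<Psi> True) S) + card (colored_trees (\<Psi> False) S)) * card S))"
  proof (intro sum.cong refl)
    fix S assume "S \<in> Pow V"
    hence "finite S" using V by (auto intro: finite_subset)
    hence "card (SIGMA d:UNIV. colored_trees (\<Psi> d) S) = card (colored_trees (\<Psi> True) S) + card (colored_trees (\<Psi> False) S)"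
      by (subst card_SigmaI) (auto simp: UNIV_bool)
    then show "card (colored_trees \<Phi> (V - S) \<times> (SIGMA d:UNIV. colored_trees (\<Psi> d) S) \<times> S) = card (colored_trees \<Phi> (V - S)) *
     ((card (colored_trees (\<Psi> True) S) + card (colored_trees (\<Psi> False) S)) * card S)"
      by (simp add: card_cartesian_product)
  qed
  finally show ?thesis .
qed

lemma sum_Pow_card:
  fixes h :: "nat \<Rightarrow> rat"
  assumes "finite V"
  shows "(\<Sum>S\<in>Pow V. h (card S)) = (\<Sum>k\<le>card V. of_nat (card V choose k) * h k)"
proof -
  have "(\<Sum>S\<in>Pow V. h (card S)) = (\<Sum>k\<le>card V. \<Sum>S | S \<in> Pow V \<and> card S = k. h (card S))"
    using assms by (intro sum.group[symmetric]) (auto intro: card_mono)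
  also have "\<dots> = (\<Sum>k\<le>card V. of_nat (card V choose k) * h k)"
    using n_subsets[OF assms] by (intro sum.cong refl) simp
  finally show ?thesis .
qed

text \<open>Coefficient \<open>n\<close> of the differential equation says that
  \<open>(n - 1) f_n\<close> is the sum of \<open>k g_k f_(n-k)\<close>. Scaled by
  \<open>fact n\<close> this is the recurrence with the subsets grouped by size.\<close>

lemma counts_from_XD:
  fixes p :: "'a set \<Rightarrow> nat" and q :: "'a set \<Rightarrow> nat" and f g :: "rat fps"
  assumes V: "finite V" "card V \<ge> 2"
    and rec: "(card V - 1) * p V = (\<Sum>S\<in>Pow V. p (V - S) * (q S * card S))"
    and p0: "p {} = 0" and f0: "f $ 0 = 0"
    and f: "fps_XD f = f + f * fps_XD g"
    and ps: "\<And>S. S \<subset> V \<Longrightarrow> S \<noteq> {} \<Longrightarrow> of_nat (p S) = f $ card S * fact (card S)"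
    and qs: "\<And>S. S \<subset> V \<Longrightarrow> S \<noteq> {} \<Longrightarrow> of_nat (q S) = g $ card S * fact (card S)"
  shows "of_nat (p V) = f $ card V * fact (card V)"
proof -
  define n where "n = card V"
  have "of_nat (n - 1) * of_nat (p V) = (\<Sum>S\<in>Pow V. of_nat (p (V - S) * (q S * card S)) :: rat)"
    using rec unfolding n_def by (metis of_nat_mult of_nat_sum)
  also have "\<dots> = (\<Sum>S\<in>Pow V. (f $ (n - card S) * fact (n - card S)) * (g $ card S * fact (card S) * of_nat (card S)))"
  proof (intro sum.cong refl)
    fix S assume "S \<in> Pow V"
    hence S: "S \<subseteq> V" "finite S" using V by (auto intro: finite_subset)
    have c: "card (V - S) = n - card S" using S by (simp add: card_Diff_subset n_def)
    \<comment> \<open>\<open>S = V\<close> contributes 0 by \<open>p0\<close> and \<open>f0\<close>,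
      and \<open>S = {}\<close> by its factor \<open>card S\<close>; all other terms involve only
      proper nonempty subsets, where \<open>ps\<close> and \<open>qs\<close> apply.\<close>
    consider "S = {}" | "S = V" | "S \<noteq> {}" "S \<subset> V" using S by blast
    then show "of_nat (p (V - S) * (q S * card S)) =
      (f $ (n - card S) * fact (n - card S)) * (g $ card S * fact (card S) * of_nat (card S))"
    proof cases
      case 3
      have "V - S \<subset> V" "V - S \<noteq> {}" using 3 by auto
      then show ?thesis using ps[of "V - S"] qs[of S] 3 by (simp add: c)
    qed (simp_all add: p0 f0 n_def)
  qed
  also have "\<dots> = (\<Sum>k\<le>n. of_nat (n choose k) * ((f $ (n - k) * fact (n - k)) * (g $ k * fact k * of_nat k)))"
    using sum_Pow_card[OF V(1)] by (simp add: n_def)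
  also have "\<dots> = (\<Sum>k\<le>n. fact n * (fps_XD g $ k * f $ (n - k)))"
    by (intro sum.cong refl) (simp add: binomial_fact divide_simps)
  also have "\<dots> = fact n * (f * fps_XD g) $ n"
    by (subst mult.commute) (simp add: fps_mult_nth sum_distrib_left atLeast0AtMost)
  also have "(f * fps_XD g) $ n = of_nat n * f $ n - f $ n"
  proof -
    have "fps_XD f $ n = (f + f * fps_XD g) $ n" by (simp only: f)
    then show ?thesis by simp
  qed
  also have "fact n * \<dots> = of_nat (n - 1) * (f $ n * fact n)"
    using V by (simp add: n_def of_nat_diff algebra_simps)
  finally show ?thesis using V by (simp add: n_def)
qed

section \<open>Root conditions and the counts of their classes\<close>

text \<open>Here \<open>k\<close> means that the root is red and \<open>s\<close> that it has a red
  child. In the notation of the outline the classes are \<open>R + G\<close>, \<open>R\<close>,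
  \<open>G\<close>, \<open>A\<close> and \<open>N\<close>, in this order.\<close>

abbreviation "root_proper \<equiv> (\<lambda>k s. k \<longleftrightarrow> \<not> s)"
abbreviation "root_red \<equiv> (\<lambda>k s. k \<and> \<not> s)"
abbreviation "root_green \<equiv> (\<lambda>k s. \<not> k \<and> s)"
abbreviation "root_nonred \<equiv> (\<lambda>k s :: bool. \<not> k)"
abbreviation "root_free \<equiv> (\<lambda>k s. \<not> k \<and> \<not> s)"

lemma card_colored_trees_proper:
  assumes "finite V"
  shows "card (colored_trees root_proper V) = card (colored_trees root_red V) + card (colored_trees root_green V)"
proof -
  have "colored_trees root_proper V = colored_trees root_red V \<union> colored_trees root_green V"
    by (auto simp: colored_trees_def)
  moreover have "colored_trees root_red V \<inter> colored_trees root_green V = {}"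
    by (auto simp: colored_trees_def)
  ultimately show ?thesis using assms by (simp add: card_Un_disjoint)
qed

lemma card_colored_trees_nonred:
  assumes "finite V"
  shows "card (colored_trees root_nonred V) = card (colored_trees root_free V) + card (colored_trees root_green V)"
proof -
  have "colored_trees root_nonred V = colored_trees root_free V \<union> colored_trees root_green V"
    by (auto simp: colored_trees_def)
  moreover have "colored_trees root_free V \<inter> colored_trees root_green V = {}"
    by (auto simp: colored_trees_def)
  ultimately show ?thesis using assms by (simp add: card_Un_disjoint)
qed

lemma dtree_singleton: "dtree {v} E \<longleftrightarrow> E = {}"
proof
  assume t: "dtree {v} E"
  then show "E = {}" using dtree_neq[OF t] unfolding dtree_def by fastforce
qed (simp add: dtree_def)

lemma colored_trees_singleton: "colored_trees \<Phi> {v} = {({}, v, K) |K. K \<subseteq> {v} \<and> \<Phi> (v \<in> K) False}"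
  by (auto simp: colored_trees_def dtree_singleton has_red_def)

lemma tree_series_1: "tree_series $ Suc 0 = 1" and red_series_1: "red_series $ Suc 0 = 1"
  by (subst tree_series_equation, simp) (subst red_series_equation, simp)

text \<open>The induction is joint because the branch classes in each recurrence are sums and
  differences of the three counts; in particular \<open>R + G\<close> agrees with \<open>A\<close>
  since \<open>R\<close> and \<open>N\<close> agree.\<close>

lemma card_colored_trees:
  fixes V :: "'a set"
  assumes "finite V" "V \<noteq> {}"
  shows "of_nat (card (colored_trees root_nonred V)) = tree_series $ card V * fact (card V)"
    "of_nat (card (colored_trees root_red V)) = red_series $ card V * fact (card V)"
    "of_nat (card (colored_trees root_free V)) = red_series $ card V * fact (card V)"
proof -
  let ?any = "\<lambda>V. of_nat (card (colored_trees root_nonred V)) = tree_series $ card V * fact (card V)"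
  let ?red = "\<lambda>V. of_nat (card (colored_trees root_red V)) = red_series $ card V * fact (card V)"
  let ?free = "\<lambda>V. of_nat (card (colored_trees root_free V)) = red_series $ card V * fact (card V)"
  have "?any V \<and> ?red V \<and> ?free V"
    using assms
  proof (induction V rule: finite_psubset_induct)
    case (psubset V)
    show ?case
    proof (cases "card V = 1")
      \<comment> \<open>The recurrence has the factor \<open>card V - 1\<close> and is void here, so
        singletons are counted directly.\<close>
      case True
      then obtain v where v: "V = {v}" by (auto simp: card_1_singleton_iff)
      have "colored_trees root_nonred V = {({}, v, {})}" "colored_trees root_red V = {({}, v, {v})}"
        "colored_trees root_free V = {({}, v, {})}"
        unfolding v colored_trees_singleton by auto
      with True show ?thesis by (simp add: tree_series_1 red_series_1)
    next
      case False
      moreover have "card V \<noteq> 0" using psubset by simp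
      ultimately have V2: "card V \<ge> 2" by linarith
      note V = psubset.hyps(1)
      have fin: "finite S" if "S \<subset> V" for S using V that by (auto intro: finite_subset)
      have IH: "?any S" "?red S" "?free S" if "S \<subset> V" "S \<noteq> {}" for S
        using psubset.IH[OF that(1) that(2)] by blast+
      have green: "of_nat (card (colored_trees root_green S)) = (tree_series - red_series) $ card S * fact (card S)"
        if "S \<subset> V" "S \<noteq> {}" for S
        using IH[OF that] card_colored_trees_nonred[OF fin[OF that(1)]] by (simp add: algebra_simps)
      have proper: "of_nat (card (colored_trees root_proper S)) = tree_series $ card S * fact (card S)"
        if "S \<subset> V" "S \<noteq> {}" for S
        using IH[OF that] green[OF that] card_colored_trees_proper[OF fin[OF that(1)]] by (simp add: algebra_simps)
      \<comment> \<open>A green root gives no help to a branch and its own children are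
        unrestricted, so the branch root obeys the rule by itself for either orientation.\<close>
      have "?any V"
      proof (rule counts_from_XD[OF V V2 _ _ _ fps_XD_tree_series])
        show "(card V - 1) * card (colored_trees root_nonred V) = (\<Sum>S\<in>Pow V. card (colored_trees root_nonred (V - S)) *
            ((card (colored_trees root_proper S) + card (colored_trees root_proper S)) * card S))"
          by (rule card_colored_trees_recurrence[OF V, where \<Psi> = "\<lambda>d. if d then root_proper else root_proper",
            unfolded if_True if_False]) (auto split: if_splits)
      qed (simp_all add: IH green proper numeral_fps_const algebra_simps)
      \<comment> \<open>A child of the red root must be green and satisfied within its branch. A
        branch root pointing to the red root must be green and is satisfied by it, whatever its
        other children.\<close>
      moreover have "?red V"
      proof (rule counts_from_XD[OF V V2 _ _ _ fps_XD_red_series])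
        show "(card V - 1) * card (colored_trees root_red V) = (\<Sum>S\<in>Pow V. card (colored_trees root_red (V - S)) *
            ((card (colored_trees root_green S) + card (colored_trees root_nonred S)) * card S))"
          by (rule card_colored_trees_recurrence[OF V, where \<Psi> = "\<lambda>d. if d then root_green else root_nonred",
            unfolded if_True if_False]) (auto split: if_splits)
      qed (simp_all add: IH green proper numeral_fps_const algebra_simps)
      \<comment> \<open>A child of the root must again be green and satisfied. A branch root
        pointing to the green root gets no help from it and obeys the rule alone.\<close>
      moreover have "?free V"
      proof (rule counts_from_XD[OF V V2 _ _ _ fps_XD_red_series])
        show "(card V - 1) * card (colored_trees root_free V) = (\<Sum>S\<in>Pow V. card (colored_trees root_free (V - S)) *
            ((card (colored_trees root_green S) + card (colored_trees root_proper S)) * card S))"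
          by (rule card_colored_trees_recurrence[OF V, where \<Psi> = "\<lambda>d. if d then root_green else root_proper",
            unfolded if_True if_False]) (auto split: if_splits)
      qed (simp_all add: IH green proper numeral_fps_const algebra_simps)
      ultimately show ?thesis by blast
    qed
  qed
  then show "?any V" "?red V" "?free V" by blast+
qed

section \<open>Transfer to well-colored directed trees\<close>

lemma pcas_imp_sym_reach:
  "pcas u p v \<Longrightarrow> set p \<subseteq> E \<union> E\<inverse> \<Longrightarrow> (u, v) \<in> sym_reach E"
proof (induction p arbitrary: u)
  case (Cons e p)
  obtain w where e: "e = (u, w)" using Cons.prems by (cases e) auto
  have "(u, w) \<in> sym_reach E" using Cons.prems e by (auto intro: sym_reach_arc sym_reach_arc')
  moreover have "(w, v) \<in> sym_reach E" using Cons e by auto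
  ultimately show ?case by (rule sym_reach_trans)
qed simp

lemma pawalk_verts_ends: "pcas u p v \<Longrightarrow> u \<in> set (pawalk_verts u p) \<and> v \<in> set (pawalk_verts u p)"
  by (induction p arbitrary: u) auto

lemma pawalk_verts_arc: "(a, b) \<in> set p \<Longrightarrow> pcas u p v \<Longrightarrow> a \<in> set (pawalk_verts u p) \<and> b \<in> set (pawalk_verts u p)"
proof (induction p arbitrary: u)
  case (Cons e p)
  then show ?case using pawalk_verts_ends[of "snd e" p v] by auto
qed simp

lemma pcas_snoc: "pcas u p v \<Longrightarrow> pcas u (p @ [(v, w)]) w"
  and pawalk_verts_snoc: "pcas u p v \<Longrightarrow> pawalk_verts u (p @ [(v, w)]) = pawalk_verts u p @ [w]"
  by (induction p arbitrary: u) auto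

text \<open>The start \<open>x\<close> lies only on the first arc, and that arc does not yet reach
  \<open>u\<close>. For a cycle of length at least 3 this says that its first edge is not traversed
  again in either direction.\<close>

lemma path_avoids_end_arc:
  assumes "pcas x q u" "distinct (pawalk_verts x q)" "2 \<le> length q"
  shows "(x, u) \<notin> set q" "(u, x) \<notin> set q"
proof -
  obtain y f r where q: "q = (x, y) # f # r"
    using assms by (cases q; cases "tl q") auto
  have p: "pcas y (f # r) u" "x \<notin> set (pawalk_verts y (f # r))" "distinct (pawalk_verts y (f # r))"
    using assms unfolding q by auto
  have "fst f = y" "pcas (snd f) r u" using p by auto
  then have "y \<noteq> u" using p(3) pawalk_verts_ends[of "snd f" r u] by auto
  moreover have "x \<noteq> y" using p pawalk_verts_ends[OF p(1)] by auto
  ultimately show "(x, u) \<notin> set q" "(u, x) \<notin> set q"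
    using pawalk_verts_arc[OF _ p(1)] p(2) pawalk_verts_ends[OF p(1)] unfolding q by fastforce+
qed

lemma parcs_mk_symmetric_with_proj: "parcs (mk_symmetric (with_proj D)) = parcs D \<union> (parcs D)\<inverse>"
  by (auto simp: parcs_mk_symmetric)

lemma rtrancl_on_sym_reach:
  assumes "E \<subseteq> V \<times> V" "u \<in> V"
  shows "(u, v) \<in> rtrancl_on V (E \<union> E\<inverse>) \<longleftrightarrow> (u, v) \<in> sym_reach E"
proof
  assume "(u, v) \<in> rtrancl_on V (E \<union> E\<inverse>)"
  then show "(u, v) \<in> sym_reach E" unfolding sym_reach_def by (rule rtrancl_on_rtranclI)
next
  assume "(u, v) \<in> sym_reach E"
  then show "(u, v) \<in> rtrancl_on V (E \<union> E\<inverse>)"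
  proof (induction rule: sym_reach_induct)
    case (step y z)
    then show ?case using assms by (auto intro: rtrancl_on_into_rtrancl_on)
  qed (use assms in auto)
qed

lemma cycle_with_proj_iff:
  "pre_digraph.cycle (with_proj G) p \<longleftrightarrow>
   (\<exists>u\<in>pverts G. set p \<subseteq> parcs G \<and> pcas u p u \<and> distinct (tl (pawalk_verts u p)) \<and> p \<noteq> [])"
  by (auto simp: pre_digraph.cycle_def pre_digraph.awalk_def awalk_verts_with_proj_eq cas_with_proj_eq)

lemma connected_iff_sym_reach:
  assumes "parcs D \<subseteq> pverts D \<times> pverts D"
  shows "Digraph_Component.connected (with_proj D) \<longleftrightarrow>
    pverts D \<noteq> {} \<and> (\<forall>u\<in>pverts D. \<forall>v\<in>pverts D. (u, v) \<in> sym_reach (parcs D))"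
  unfolding connected_def strongly_connected_def reachable_def
  using rtrancl_on_sym_reach[OF assms]
  by (simp add: parcs_mk_symmetric_with_proj)

lemma directed_tree_imp_dtree:
  assumes "directed_tree D"
  shows "dtree (pverts D) (parcs D)"
proof -
  interpret pair_digraph D using assms by (simp add: directed_tree_def)
  let ?V = "pverts D" and ?E = "parcs D"
  have EV: "?E \<subseteq> ?V \<times> ?V" using arc_fst_in_verts arc_snd_in_verts by fastforce
  have "e \<notin> sym_reach (?E - {e})" if "e \<in> ?E" for e
  proof
    assume r: "e \<in> sym_reach (?E - {e})"
    obtain a b where e: "e = (a, b)" by (cases e)
    have ab: "a \<in> ?V" "b \<in> ?V" "a \<noteq> b" using that EV pair_no_loops[OF that] by (auto simp: e)
    define F where "F = (?E - {e}) \<union> (?E - {e})\<inverse>"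
    \<comment> \<open>In this symmetric digraph without \<open>e\<close> the bypass can be shortened
      to a path, which \<open>e\<close> then closes to a cycle.\<close>
    define H where "H = \<lparr>pverts = ?V, parcs = F\<rparr>"
    interpret H: pair_wf_digraph H
      by unfold_locales (use EV in \<open>auto simp: H_def F_def\<close>)
    have "(a, b) \<in> rtrancl_on ?V F"
      using r rtrancl_on_sym_reach[of "?E - {e}" ?V a b] EV ab unfolding e F_def by blast
    then have "reachable (with_proj H) a b"
      by (simp add: reachable_def H_def)
    then obtain p where p: "pre_digraph.apath (with_proj H) a p b"
      using H.reachable_apath by blast
    have p: "pcas a p b" "set p \<subseteq> F" "distinct (pawalk_verts a p)"
      using p by (auto simp: pre_digraph.apath_def pre_digraph.awalk_def awalk_verts_with_proj_eq
        cas_with_proj_eq H_def)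
    \<comment> \<open>Antisymmetry excludes the arc \<open>(b, a)\<close>, so the bypass is not a
      single step; this makes the cycle long enough.\<close>
    have Fab: "(a, b) \<notin> F"
      using assms that ab unfolding F_def e directed_tree_def by (auto dest: antisymD)
    have len: "2 \<le> length p"
      using p ab Fab by (cases p; cases "tl p") auto
    let ?p = "p @ [(b, a)]"
    have "distinct (tl (pawalk_verts a ?p))"
      using p(3,1) len by (cases p) (auto simp: pawalk_verts_snoc)
    moreover have "set ?p \<subseteq> parcs (mk_symmetric (with_proj D))"
      using p(2) that unfolding parcs_mk_symmetric_with_proj F_def e by auto
    ultimately have "pre_digraph.cycle (with_proj (mk_symmetric (with_proj D))) ?p"
      unfolding cycle_with_proj_iff using pcas_snoc[OF p(1)] ab by (intro bexI[of _ a]) auto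
    moreover have "3 \<le> length ?p" using len by simp
    ultimately show False using assms unfolding directed_tree_def by blast
  qed
  then show ?thesis
    using assms EV pair_finite_verts unfolding directed_tree_def connected_iff_sym_reach[OF EV] dtree_def
    by blast
qed

text \<open>Opposite arcs would bypass each other, and in a cycle of length at least 3 the other
  arcs would bypass the first.\<close>

lemma dtree_imp_directed_tree:
  assumes t: "dtree (pverts D) (parcs D)"
  shows "directed_tree D"
proof -
  let ?V = "pverts D" and ?E = "parcs D"
  have EV: "?E \<subseteq> ?V \<times> ?V" and br: "\<And>e. e \<in> ?E \<Longrightarrow> e \<notin> sym_reach (?E - {e})" and fin: "finite ?V"
    using t by (auto simp: dtree_def)
  have "pair_digraph D"
    by unfold_locales (use EV fin dtree_neq[OF t] in \<open>auto intro: finite_subset\<close>)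
  moreover have "antisym ?E"
  proof (rule antisymI, rule ccontr)
    fix a b assume ab: "(a, b) \<in> ?E" "(b, a) \<in> ?E" "a \<noteq> b"
    then have "(a, b) \<in> sym_reach (?E - {(a, b)})" by (auto intro: sym_reach_arc')
    with br ab show False by blast
  qed
  moreover have "Digraph_Component.connected (with_proj D)"
    unfolding connected_iff_sym_reach[OF EV] using t by (auto simp: dtree_def)
  moreover have False if c: "pre_digraph.cycle (with_proj (mk_symmetric (with_proj D))) p" "3 \<le> length p" for p
  proof -
    obtain u where u: "set p \<subseteq> ?E \<union> ?E\<inverse>" "pcas u p u" "distinct (tl (pawalk_verts u p))"
      using c unfolding cycle_with_proj_iff parcs_mk_symmetric_with_proj by blast
    obtain x q where p: "p = (u, x) # q" using c u by (cases p) auto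
    have q: "pcas x q u" "distinct (pawalk_verts x q)" "2 \<le> length q" "set q \<subseteq> ?E \<union> ?E\<inverse>"
      using u c unfolding p by auto
    note av = path_avoids_end_arc[OF q(1-3)]
    obtain e where e: "e \<in> ?E" "e = (u, x) \<or> e = (x, u)" using u(1) unfolding p by auto
    have "set q \<subseteq> (?E - {e}) \<union> (?E - {e})\<inverse>" using q(4) av e by auto
    then have "(x, u) \<in> sym_reach (?E - {e})" using q(1) by (intro pcas_imp_sym_reach)
    then have "e \<in> sym_reach (?E - {e})" using e by (auto dest: sym_reach_sym)
    with br e show False by blast
  qed
  ultimately show ?thesis unfolding directed_tree_def by blast
qed

lemma labeled_directed_tree_iff: "labeled_directed_tree n D \<longleftrightarrow> pverts D = {1..n} \<and> dtree {1..n} (parcs D)"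
  using directed_tree_imp_dtree dtree_imp_directed_tree unfolding labeled_directed_tree_def by metis

section \<open>Colorings as red sets\<close>

text \<open>Outside \<open>{1..n}\<close> an extensional coloring takes the value
  \<open>undefined\<close>, which may be \<open>Red\<close>; hence the restriction.\<close>

definition red_set :: "nat \<Rightarrow> (nat \<Rightarrow> color) \<Rightarrow> nat set" where
  "red_set n c = {u\<in>{1..n}. c u = Red}"

lemma well_coloring_iff:
  assumes "pverts D = {1..n}" "parcs D \<subseteq> {1..n} \<times> {1..n}"
  shows "well_coloring D c \<longleftrightarrow> c \<in> extensional {1..n} \<and>
    (\<forall>u\<in>{1..n}. u \<in> red_set n c \<longleftrightarrow> \<not> has_red (parcs D) (red_set n c) u)"
proof -
  have "has_red (parcs D) (red_set n c) u \<longleftrightarrow> (\<exists>v. (u, v) \<in> parcs D \<and> c v = Red)" for u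
    using assms(2) unfolding has_red_def red_set_def by blast
  moreover have "c u = Green \<longleftrightarrow> c u \<noteq> Red" for u by (cases "c u") auto
  ultimately show ?thesis
    unfolding well_coloring_def assms(1) by (auto simp: red_set_def)
qed

text \<open>An extensional coloring is recovered from its red set, and the digraph from its arcs
  because the vertex set is fixed. \<open>root_proper\<close> imposes the rule on the root as
  well.\<close>

lemma bij_betw_rooted_well_colored:
  "bij_betw (\<lambda>((D, v), c). (parcs D, v, red_set n c)) (rooted_well_colored n) (colored_trees root_proper {1..n})"
  (is "bij_betw ?f ?A ?B")
proof -
  let ?g = "\<lambda>(E, v, K). ((\<lparr>pverts = {1..n}, parcs = E\<rparr>, v),
    \<lambda>u\<in>{1..n}. if u \<in> K then Red else Green)"
  have D: "D = \<lparr>pverts = {1..n}, parcs = parcs D\<rparr>" if "pverts D = {1..n}" for D :: "nat pair_pre_digraph"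
    using that by simp
  have c: "c = (\<lambda>u\<in>{1..n}. if u \<in> red_set n c then Red else Green)" if "c \<in> extensional {1..n}" for c
  proof
    fix u show "c u = (\<lambda>u\<in>{1..n}. if u \<in> red_set n c then Red else Green) u"
      using that by (cases "c u") (auto simp: red_set_def restrict_def extensional_def)
  qed
  have rs: "red_set n (\<lambda>u\<in>{1..n}. if u \<in> K then Red else Green) = K" if "K \<subseteq> {1..n}" for K
    using that by (auto simp: red_set_def)
  have m: "((D, v), c) \<in> ?A \<longleftrightarrow> pverts D = {1..n} \<and> c \<in> extensional {1..n} \<and> (parcs D, v, red_set n c) \<in> ?B"
    for D v c
  proof (cases "pverts D = {1..n} \<and> dtree {1..n} (parcs D)")
    case True
    then have "parcs D \<subseteq> {1..n} \<times> {1..n}" by (simp add: dtree_def)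
    note wc = well_coloring_iff[OF conjunct1[OF True] this]
    from True have "((D, v), c) \<in> ?A \<longleftrightarrow> v \<in> {1..n} \<and> c \<in> extensional {1..n} \<and>
        (\<forall>u\<in>{1..n}. u \<in> red_set n c \<longleftrightarrow> \<not> has_red (parcs D) (red_set n c) u)"
      by (simp add: rooted_well_colored_def labeled_directed_tree_iff wc)
    moreover have "(parcs D, v, red_set n c) \<in> ?B \<longleftrightarrow> v \<in> {1..n} \<and>
        (\<forall>u\<in>{1..n} - {v}. u \<in> red_set n c \<longleftrightarrow> \<not> has_red (parcs D) (red_set n c) u) \<and>
        (v \<in> red_set n c \<longleftrightarrow> \<not> has_red (parcs D) (red_set n c) v)"
    proof -
      have "red_set n c \<subseteq> {1..n}" by (auto simp: red_set_def)
      with True show ?thesis by (simp add: colored_trees_def)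
    qed
    ultimately show ?thesis using True by blast
  next
    case False
    then show ?thesis
      by (auto simp: rooted_well_colored_def labeled_directed_tree_iff colored_trees_def)
  qed
  have "\<forall>a\<in>?A. ?g (?f a) = a"
  proof
    fix a assume "a \<in> ?A"
    moreover obtain D v c where a: "a = ((D, v), c)" by (metis surj_pair)
    ultimately have "pverts D = {1..n}" "c \<in> extensional {1..n}" by (simp_all add: m)
    from D[OF this(1), symmetric] c[OF this(2), symmetric] show "?g (?f a) = a"
      unfolding a prod.case by (simp only:)
  qed
  moreover have "\<forall>b\<in>?B. ?f (?g b) = b"
    using rs by (auto simp: colored_trees_def)
  moreover have "?f ` ?A \<subseteq> ?B" using m by auto
  moreover have "?g ` ?B \<subseteq> ?A"
  proof clarify
    fix E v K assume B: "(E, v, K) \<in> ?B"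
    then have "K \<subseteq> {1..n}" by (simp add: colored_trees_def)
    from B rs[OF this] show "((\<lparr>pverts = {1..n}, parcs = E\<rparr>, v), \<lambda>u\<in>{1..n}. if u \<in> K then Red else Green) \<in> ?A"
      unfolding m by simp
  qed
  ultimately show ?thesis by (rule bij_betw_byWitness)
qed

lemma num_t_eq: "num_t n = card (colored_trees root_proper {1..n})"
  unfolding num_t_def by (rule bij_betw_same_card[OF bij_betw_rooted_well_colored])

lemma num_r_eq: "num_r n = card (colored_trees root_red {1..n})"
proof -
  have "bij_betw (\<lambda>((D, v), c). (parcs D, v, red_set n c)) {((D, v), c) \<in> rooted_well_colored n. c v = Red}
      (colored_trees root_red {1..n})" (is "bij_betw ?f ?A _")
  proof (rule bij_betw_subset[OF bij_betw_rooted_well_colored])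
    have v: "v \<in> {1..n}" if "((D, v), c) \<in> rooted_well_colored n" for D v c
      using that by (auto simp: rooted_well_colored_def labeled_directed_tree_def)
    have "?A = {a \<in> rooted_well_colored n. fst (snd (?f a)) \<in> snd (snd (?f a))}"
      using v by (auto simp: red_set_def)
    then have "?f ` ?A = {b \<in> ?f ` rooted_well_colored n. fst (snd b) \<in> snd (snd b)}" by blast
    also have "?f ` rooted_well_colored n = colored_trees root_proper {1..n}"
      using bij_betw_rooted_well_colored by (rule bij_betw_imp_surj_on)
    finally show "?f ` ?A = colored_trees root_red {1..n}"
      by (auto simp: colored_trees_def)
  qed auto
  then show ?thesis unfolding num_r_def by (rule bij_betw_same_card)
qed

lemma finite_rooted_well_colored [simp]: "finite (rooted_well_colored n)"
  using bij_betw_finite[OF bij_betw_rooted_well_colored, of n] by simp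

lemma num_t_split: "num_t n = num_r n + num_g n"
proof -
  have "rooted_well_colored n = {((D, v), c) \<in> rooted_well_colored n. c v = Red} \<union>
      {((D, v), c) \<in> rooted_well_colored n. c v = Green}"
    by (auto intro: color.exhaust)
  then have "num_t n = card ({((D, v), c) \<in> rooted_well_colored n. c v = Red} \<union>
      {((D, v), c) \<in> rooted_well_colored n. c v = Green})"
    by (simp add: num_t_def)
  also have "\<dots> = num_r n + num_g n" unfolding num_r_def num_g_def
    by (rule card_Un_disjoint) (auto intro: finite_subset[OF _ finite_rooted_well_colored])
  finally show ?thesis .
qed

text \<open>Well-colorings ignore the root, so each of the \<open>n\<close> vertices can be
  chosen.\<close>

lemma num_t_unrooted: "num_t n = n * num_unrooted n"
proof -
  let ?U = "{(D, c). labeled_directed_tree n D \<and> well_coloring D c}"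
  have "bij_betw (\<lambda>((D, c), v). ((D, v), c)) (?U \<times> {1..n}) (rooted_well_colored n)"
    by (rule bij_betw_byWitness[where f' = "\<lambda>((D, v), c). ((D, c), v)"])
      (auto simp: rooted_well_colored_def labeled_directed_tree_def)
  then have "num_t n = card (?U \<times> {1..n})" unfolding num_t_def by (rule bij_betw_same_card[symmetric])
  then show ?thesis by (simp add: card_cartesian_product num_unrooted_def mult.commute)
qed

section \<open>The identities between the generating functions\<close>

lemma T_r_eq: "T_r = red_series"
proof (rule fps_ext)
  fix n show "T_r $ n = red_series $ n"
    using card_colored_trees(2)[of "{1..n}"] by (simp add: T_r_def egf_nth num_r_eq)
qed

text \<open>\<open>T\<close> counts the class \<open>R + G\<close>, whereas
  \<open>tree_series\<close> counts \<open>A = N + G\<close>; they agree because \<open>R\<close>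
  and \<open>N\<close> have equal counts.\<close>

lemma T_eq: "T = tree_series"
proof (rule fps_ext)
  fix n show "T $ n = tree_series $ n"
    using card_colored_trees[of "{1..n}"] card_colored_trees_nonred[of "{1..n}"] card_colored_trees_proper[of "{1..n}"]
    by (simp add: T_def egf_nth num_t_eq field_simps)
qed

lemma T_g_eq: "T_g = T - T_r"
  by (rule fps_ext) (simp add: T_g_def T_def T_r_def egf_nth num_t_split field_simps)

lemma T_g_unr_eq: "T_g_unr = T_unr - T_r_unr"
  by (rule fps_ext) (simp add: T_g_unr_def T_unr_def T_r_unr_def egf_nth num_t_split field_simps)

lemma fps_XD_egf_div: "fps_XD (egf (\<lambda>n. a n / of_nat n)) = egf a"
  by (rule fps_ext) (simp add: egf_nth)

text \<open>Unrooting inverts the Euler operator, and \<open>X T' (1 - 2 T) = T\<close>; the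
  constant terms are both 0.\<close>

lemma T_unr_eq: "T_unr = T - T\<^sup>2"
proof -
  have "fps_XD (T - T\<^sup>2) = fps_XD T - 2 * T * fps_XD T"
    by (simp add: fps_XD_def power2_eq_square algebra_simps)
  also have "\<dots> = T"
  proof -
    have "fps_XD (2 * T) = 2 * fps_XD T" by (simp add: fps_XD_def mult_ac)
    then have "fps_XD T = T + T * (2 * fps_XD T)"
      using fps_XD_tree_series unfolding T_eq by simp
    then show ?thesis by algebra
  qed
  finally have "fps_XD T_unr = fps_XD (T - T\<^sup>2)"
    unfolding T_unr_def fps_XD_egf_div by (simp add: T_def)
  then show ?thesis
    by (subst (asm) fps_XD_eq_iff) (simp_all add: T_unr_def T_eq power2_eq_square)
qed

lemma T_r_unr_eq: "T_r_unr = 2 + 2 * T - 2 * T * T_r + T_r - 2 * T / T_r + T_r\<^sup>2 / 2"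
proof -
  define u where "u = fps_exp 1 oo red_series"
  have tr: "T = T_r * u" unfolding T_eq T_r_eq u_def by (rule tree_series_eq_red)
  have "T_r $ 1 = 1" by (simp add: T_r_eq red_series_1)
  hence "T_r \<noteq> 0" by auto
  \<comment> \<open>\<open>T_r\<close> is not a unit, but the numerator is a multiple of it, so the
    quotient is exact.\<close>
  have "2 * T / T_r = T_r * (2 * u) / T_r" unfolding tr by (simp only: mult.left_commute)
  also have "\<dots> = 2 * u" using \<open>T_r \<noteq> 0\<close> by (rule nonzero_mult_div_cancel_left)
  finally have q: "2 * T / T_r = 2 * u" .
  let ?R = "2 + 2 * T - 2 * T * T_r + T_r - 2 * u + T_r\<^sup>2 / 2"
  have u': "fps_XD u = fps_XD T_r * u"
    by (simp add: u_def T_r_eq fps_XD_def fps_compose_deriv mult_ac)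
  have "fps_XD ?R = T_r"
    by (rule fps_XD_red_unrooted[OF _ _ tr u'])
      (use fps_XD_tree_series fps_XD_red_series in \<open>simp_all add: T_eq T_r_eq\<close>)
  then have "fps_XD T_r_unr = fps_XD ?R"
    unfolding T_r_unr_def fps_XD_egf_div by (simp add: T_r_def)
  \<comment> \<open>The constant term of \<open>u\<close> is 1, so the summand 2 is what makes the
    constant term of \<open>?R\<close> vanish.\<close>
  moreover have "T_r_unr $ 0 = ?R $ 0"
    by (simp add: T_r_unr_def T_eq T_r_eq u_def numeral_fps_const fps_divide_unit power2_eq_square)
  ultimately show ?thesis unfolding q by (simp only: fps_XD_eq_iff)
qed

theorem theorem1:
  shows "(\<forall>F :: rat fps. F = fps_X * (fps_exp 1 oo F) \<longleftrightarrow> F = cayley) \<and>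
    T = (cayley oo (2 * fps_X)) / 2 \<and>
    T_r = - (cayley oo (- ((cayley oo (2 * fps_X)) / 2))) \<and>
    T_g = (cayley oo (2 * fps_X)) / 2 + (cayley oo (- ((cayley oo (2 * fps_X)) / 2))) \<and>
    T_unr = egf (\<lambda>n. of_nat (num_unrooted n)) \<and>
    T_unr = T - T\<^sup>2 \<and>
    T_g_unr = T_unr - T_r_unr \<and>
    T_r_unr = 2 + 2 * T - 2 * T * T_r + T_r - 2 * T / T_r + T_r\<^sup>2 / 2"
proof (intro conjI allI)
  show T: "T = (cayley oo (2 * fps_X)) / 2" by (simp only: T_eq tree_series_def)
  show Tr: "T_r = - (cayley oo (- ((cayley oo (2 * fps_X)) / 2)))"
    by (simp only: T_r_eq red_series_def tree_series_def)
  show "T_g = (cayley oo (2 * fps_X)) / 2 + (cayley oo (- ((cayley oo (2 * fps_X)) / 2)))"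
    unfolding T_g_eq T[symmetric] by (simp add: Tr[folded T])
  show "T_unr = egf (\<lambda>n. of_nat (num_unrooted n))"
    by (rule fps_ext) (simp add: T_unr_def egf_nth num_t_unrooted)
qed (rule tree_equation_iff_cayley T_unr_eq T_g_unr_eq T_r_unr_eq)+

end
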